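(* Let $n$ be a positive integer, let $R$ be a simply connected region, and let $v_0$ be a vertex on the boundary of $R$. The map $\alpha\mapsto h_\alpha$ is a one-to-one correspondence between the order-$n$ ribbon tilings $\alpha$ of $R$ and the functions $h$ from the vertices of $R$ to $\mathbb Z^n$ satisfying the following three conditions, where $e_{0,1},e_{1,2},\dots,e_{n-1,0}$ denotes the standard basis of $\mathbb Z^n$: (1) $h(v_0)=0$; (2) if $(v,w)$ is an oriented boundary edge of $R$ of type $(i,i+1)$ with its square of color $i+1$ (the higher-level one) on the left, then $h(w)-h(v)=e_{i,i+1}$; (3) if $(v,w)$ is an oriented interior edge of $R$ of type $(i,i+1)$ with its square of color $i+1$ (the higher-level one) on the left, then $h(w)-h(v)\in\{e_{i,i+1}\}\cup\{2e_{j,j+1}-e_{i,i+1} : j\in\mathbb Z/n\mathbb Z,\ j\ne i\}$.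
   Context: Squares of the grid $\mathbb Z^2$ are indexed by integer pairs; $s_{x,y}$ is the unit square at position $(x,y)$. Two squares are adjacent if they share an edge. The square $s_{x,y}$ has level $x+y$ and color $x+y\bmod n$; colors are added modulo $n$. A ribbon tile of order $n$ is a connected set of squares containing exactly one square of each of the $n$ colors. A tile has type $(j,j+1)$ if its lowest-level square has color $j+1$ and its highest-level square has color $j$. Each edge of the grid separates a square of some level $c$ from one of level $c+1$; it has type $(i,i+1)$ if the lower-level square has color $i$ and the higher-level square has color $i+1$. A region is a finite set $R$ of squares that is connected via adjacency. It is simply connected if, for every square $s\notin R$, there is no connected cycle of squares in $R$ that encircles $s$ with a non-zero winding number. Vertices of $R$ are the corners of its squares. An edge is an interior edge of $R$ if both squares it separates are in $R$, and a boundary edge of $R$ if exactly one is; a boundary vertex is an endpoint of a boundary edge. An order-$n$ ribbon tiling of $R$ is a partition of $R$ into ribbon tiles of order $n$. An edge crosses a tile $t$ if both squares it separates belong to $t$. For an order-$n$ ribbon tiling $\alpha$ of $R$, the height function $h_\alpha$ from the vertices of $R$ to $\mathbb Z^n$ is described by the following rules: $h_\alpha(v_0)=0$ and, when moving from $v$ to $w$ along an edge of type $(i,i+1)$ incident to a square of $R$, with the square of color $i+1$ (the higher-level square) on the left, $h_\alpha(w)-h_\alpha(v)=e_{i,i+1}$ if the edge crosses no tile of $\alpha$, and $h_\alpha(w)-h_\alpha(v)=2e_{j,j+1}-e_{i,i+1}$ if the edge crosses a tile of $\alpha$ of type $(j,j+1)$.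
   Formalization: Where squares of R meet at a grid point only diagonally, that point counts as several vertices of R, one per group of squares joined by adjacency there; with bare grid points the claim fails for some simply connected R. Otherwise vertices are as stated. *)

theory Defs
  imports
    "HOL-Complex_Analysis.Winding_Numbers"
    "HOL-Library.FuncSet"
    "HOL-Library.Disjoint_Sets"
    "Jordan_Normal_Form.Matrix"
begin

section \<open>Squares, levels and colors\<close>

text \<open>The square (x, y) is the unit square with lower left corner (x, y).\<close>

type_synonym square = "int \<times> int"
type_synonym point = "int \<times> int"

definition level :: "square \<Rightarrow> int" where
  "level s = fst s + snd s"

definition color :: "nat \<Rightarrow> square \<Rightarrow> nat" where
  "color n s = nat (level s mod int n)"

definition adjacent :: "square \<Rightarrow> square \<Rightarrow> bool" where
  "adjacent s t \<longleftrightarrow>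
     (fst s = fst t \<and> \<bar>snd s - snd t\<bar> = 1) \<or> (snd s = snd t \<and> \<bar>fst s - fst t\<bar> = 1)"

definition corners :: "square \<Rightarrow> point set" where
  "corners s = {fst s, fst s + 1} \<times> {snd s, snd s + 1}"

definition component :: "square set \<Rightarrow> square \<Rightarrow> square set" where
  "component A s = {t. (s, t) \<in> {(a, b). a \<in> A \<and> b \<in> A \<and> adjacent a b}\<^sup>*}"

definition connected_squares :: "square set \<Rightarrow> bool" where
  "connected_squares A \<longleftrightarrow> (\<forall>s\<in>A. \<forall>t\<in>A. t \<in> component A s)"

section \<open>Regions\<close>

definition region :: "square set \<Rightarrow> bool" where
  "region R \<longleftrightarrow> finite R \<and> connected_squares R"

definition center :: "square \<Rightarrow> complex" where
  "center s = Complex (of_int (fst s) + 1/2) (of_int (snd s) + 1/2)"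

fun center_path :: "square list \<Rightarrow> real \<Rightarrow> complex" where
  "center_path (s # t # ss) = linepath (center s) (center t) +++ center_path (t # ss)"
| "center_path [s] = linepath (center s) (center s)"
| "center_path [] = linepath 0 0"

definition square_cycle :: "square set \<Rightarrow> square list \<Rightarrow> bool" where
  "square_cycle R ss \<longleftrightarrow>
     ss \<noteq> [] \<and> set ss \<subseteq> R \<and> successively adjacent ss \<and> hd ss = last ss"

definition simply_connected_region :: "square set \<Rightarrow> bool" where
  "simply_connected_region R \<longleftrightarrow>
     region R \<and>
     (\<forall>s. s \<notin> R \<longrightarrow>
        \<not> (\<exists>ss. square_cycle R ss \<and> winding_number (center_path ss) (center s) \<noteq> 0))"

section \<open>Vertices and edges of a region\<close>

text \<open>
  A vertex of R is a corner p of a square of R. The definition of simple connectivity only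
  sees cycles of squares that share edges, so R may have two squares meeting at p only
  diagonally, their two common neighbours being outside R. Such a region touches itself at p,
  and it is simply connected only if the two corners meeting there are kept apart: around a
  square enclosed with the help of such a point, the boundary increments of a height
  function need not add up to 0. Corners of squares of R are therefore identified along
  adjacent squares of R: a vertex is a pair (p, C) where C is one of the components, with respect
  to adjacency, of the set of squares of R that have p as a corner. If no two squares
  of R meet only diagonally, C is determined by p and the vertices are just the grid points that
  are corners of squares of R (see the two lemmas below).
\<close>

type_synonym vertex = "point \<times> square set"

definition squares_at :: "square set \<Rightarrow> point \<Rightarrow> square set" where
  "squares_at R p = {s \<in> R. p \<in> corners s}"

definition vertex_at :: "square set \<Rightarrow> point \<Rightarrow> square \<Rightarrow> vertex" where
  "vertex_at R p s = (p, component (squares_at R p) s)"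

definition vertices :: "square set \<Rightarrow> vertex set" where
  "vertices R = {vertex_at R p s | p s. s \<in> R \<and> p \<in> corners s}"

lemma component_subset: "s \<in> A \<Longrightarrow> component A s \<subseteq> A"
proof
  fix t assume "s \<in> A" "t \<in> component A s"
  then show "t \<in> A"
    unfolding component_def by (auto elim: rtranclE)
qed

lemma fst_vertices: "fst ` vertices R = (\<Union>s\<in>R. corners s)"
  by (force simp: vertices_def vertex_at_def image_iff)

lemma inj_on_fst_vertices:
  assumes "\<And>p. connected_squares (squares_at R p)"
  shows "inj_on fst (vertices R)"
proof -
  have "component (squares_at R p) s = squares_at R p" if "s \<in> R" "p \<in> corners s" for p s
    using assms[of p] that component_subset[of s "squares_at R p"]
    unfolding connected_squares_def squares_at_def by blast
  then show ?thesis
    by (auto simp: inj_on_def vertices_def vertex_at_def)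
qed

text \<open>
  The grid edge from p to q, oriented so that of the two squares it separates, the one of
  higher level (hi) is on the left and the one of lower level (lo) on the right. Such an
  edge points east, with hi to its north, or south, with hi to its east.
\<close>

inductive grid_edge :: "point \<Rightarrow> point \<Rightarrow> square \<Rightarrow> square \<Rightarrow> bool" where
  east: "grid_edge (x, y) (x + 1, y) (x, y - 1) (x, y)"
| south: "grid_edge (x, y) (x, y - 1) (x - 1, y - 1) (x, y - 1)"

lemma grid_edge_level: "grid_edge p q lo hi \<Longrightarrow> level hi = level lo + 1"
  by (auto elim!: grid_edge.cases simp: level_def)

lemma grid_edge_corners: "grid_edge p q lo hi \<Longrightarrow> corners lo \<inter> corners hi = {p, q}"
  by (auto elim!: grid_edge.cases simp: corners_def)

lemma ex_grid_edge:
  "(\<exists>p q. grid_edge p q lo hi) \<longleftrightarrow> adjacent lo hi \<and> level lo < level hi"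
proof
  assume "\<exists>p q. grid_edge p q lo hi"
  then show "adjacent lo hi \<and> level lo < level hi"
    by (auto elim!: grid_edge.cases simp: adjacent_def level_def)
next
  assume *: "adjacent lo hi \<and> level lo < level hi"
  obtain x y where lo: "lo = (x, y)" by (cases lo)
  from * have "hi = (x, y + 1) \<or> hi = (x + 1, y)"
    unfolding lo by (cases hi) (auto simp: adjacent_def level_def)
  then show "\<exists>p q. grid_edge p q lo hi"
    using east[of x "y + 1"] south[of "x + 1" "y + 1"] unfolding lo by auto
qed

text \<open>
  An edge of R from the vertex v to the vertex w, oriented as above. If both squares lie in
  R, then either of them may serve as s.
\<close>

definition region_edge :: "square set \<Rightarrow> square \<Rightarrow> square \<Rightarrow> vertex \<Rightarrow> vertex \<Rightarrow> bool" where
  "region_edge R lo hi v w \<longleftrightarrow>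
     (\<exists>p q s. grid_edge p q lo hi \<and> s \<in> R \<inter> {lo, hi} \<and>
              v = vertex_at R p s \<and> w = vertex_at R q s)"

definition boundary_edge :: "square set \<Rightarrow> square \<Rightarrow> square \<Rightarrow> vertex \<Rightarrow> vertex \<Rightarrow> bool" where
  "boundary_edge R lo hi v w \<longleftrightarrow> region_edge R lo hi v w \<and> (lo \<in> R) \<noteq> (hi \<in> R)"

definition interior_edge :: "square set \<Rightarrow> square \<Rightarrow> square \<Rightarrow> vertex \<Rightarrow> vertex \<Rightarrow> bool" where
  "interior_edge R lo hi v w \<longleftrightarrow> region_edge R lo hi v w \<and> lo \<in> R \<and> hi \<in> R"

definition boundary_vertices :: "square set \<Rightarrow> vertex set" where
  "boundary_vertices R = {v. \<exists>lo hi w. boundary_edge R lo hi v w \<or> boundary_edge R lo hi w v}"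

section \<open>Ribbon tilings\<close>

definition ribbon_tile :: "nat \<Rightarrow> square set \<Rightarrow> bool" where
  "ribbon_tile n t \<longleftrightarrow> connected_squares t \<and> (\<forall>c<n. \<exists>!s. s \<in> t \<and> color n s = c)"

text \<open>The tile t has type (j, j+1).\<close>

definition tile_type :: "nat \<Rightarrow> square set \<Rightarrow> nat \<Rightarrow> bool" where
  "tile_type n t j \<longleftrightarrow>
     (\<exists>s\<in>t. (\<forall>u\<in>t. level s \<le> level u) \<and> color n s = (j + 1) mod n) \<and>
     (\<exists>s\<in>t. (\<forall>u\<in>t. level u \<le> level s) \<and> color n s = j)"

definition ribbon_tilings :: "nat \<Rightarrow> square set \<Rightarrow> square set set set" where
  "ribbon_tilings n R = {\<alpha>. partition_on R \<alpha> \<and> (\<forall>t\<in>\<alpha>. ribbon_tile n t)}"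

section \<open>Height functions\<close>

text \<open>
  The group of integer vectors of length n is \<open>carrier_vec n\<close>, and the basis vector
  with index pair (i, i+1) is \<open>unit_vec n i\<close>. Maps are extensional on the vertices of R.
\<close>

definition is_height_function ::
  "nat \<Rightarrow> square set \<Rightarrow> vertex \<Rightarrow> square set set \<Rightarrow> (vertex \<Rightarrow> int Matrix.vec) \<Rightarrow> bool" where
  "is_height_function n R v0 \<alpha> h \<longleftrightarrow>
     h \<in> vertices R \<rightarrow>\<^sub>E carrier_vec n \<and>
     h v0 = 0\<^sub>v n \<and>
     (\<forall>lo hi v w. region_edge R lo hi v w \<longrightarrow>
        ((\<nexists>t. t \<in> \<alpha> \<and> lo \<in> t \<and> hi \<in> t) \<longrightarrow> h w - h v = unit_vec n (color n lo)) \<and>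
        (\<forall>t j. t \<in> \<alpha> \<and> lo \<in> t \<and> hi \<in> t \<and> tile_type n t j \<longrightarrow>
           h w - h v = 2 \<cdot>\<^sub>v unit_vec n j - unit_vec n (color n lo)))"

definition height_function ::
  "nat \<Rightarrow> square set \<Rightarrow> vertex \<Rightarrow> square set set \<Rightarrow> vertex \<Rightarrow> int Matrix.vec" where
  "height_function n R v0 \<alpha> = (THE h. is_height_function n R v0 \<alpha> h)"

end

theory Submission
  imports Defs
begin

text \<open>
  Increments along edges extend to a function on the vertices iff they add up to 0 around
  every square of R: summing them along cycles of squares, a discrete Stokes theorem expresses such
  a sum through the winding numbers of the cycle around grid points, and these vanish at the
  corners of squares outside R. For the increments of a tiling, the edges entering a square of a
  tile of type (j, j+1) contribute 2 times the basis vector j, and so do the edges leaving it.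
  Conversely, if the increments of a function with properties (2) and (3) add up to 0 around a square,
  at most one of the edges entering it and at most one of those leaving it are crossed, with a
  common j; there is no crossed edge entering it iff its color is j+1, and none leaving it iff
  its color is j. So the squares linked by crossed edges form ribbon tiles.
\<close>

text \<open>Simple connectivity speaks of cycles of squares and of centers of squares outside R,
  while heights live on vertices, and several vertices may lie over one grid point. Hence a
  potential is first built on squares, as the height at the lower left corner, and then spread to
  the other corners; adjacent squares agree at the corners they share, which makes the value at a
  vertex well defined. Each coordinate of the increments is integrated separately, with integer
  values. A grid point can obstruct this only if one of its four squares is missing from R, and then
  it can be joined to the center of that square without meeting the cycle. In the converse direction
  the length of a chain of linked squares is not found by following it: the label j shared by its
  squares and the level of a square determine, modulo n, how many squares lie above it, and this
  residue drops by one with each step up.\<close>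

fun path_sum :: "('a \<Rightarrow> 'a \<Rightarrow> int) \<Rightarrow> 'a list \<Rightarrow> int" where
  "path_sum g (s # t # ss) = g s t + path_sum g (t # ss)"
| "path_sum g [s] = 0"
| "path_sum g [] = 0"

lemma path_sum_append:
  "path_sum g (xs @ x # ys) = path_sum g (xs @ [x]) + path_sum g (x # ys)"
proof (induction xs)
  case (Cons a xs)
  then show ?case by (cases xs) auto
qed simp

section \<open>Adjacency, walks in components, and potentials on squares\<close>

lemma adjacent_sym: "adjacent s t \<Longrightarrow> adjacent t s"
  by (auto simp: adjacent_def)

lemma adjacent_cases:
  assumes "adjacent s t"
  obtains "t = (fst s + 1, snd s)" | "s = (fst t + 1, snd t)"
    | "t = (fst s, snd s + 1)" | "s = (fst t, snd t + 1)"
proof -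
  have "t = (fst s + 1, snd s) \<or> s = (fst t + 1, snd t) \<or>
      t = (fst s, snd s + 1) \<or> s = (fst t, snd t + 1)"
    using assms by (cases s; cases t) (auto simp: adjacent_def)
  then show thesis using that by blast
qed

lemma component_refl: "s \<in> component A s"
  by (simp add: component_def)

lemma component_induct [consumes 1, case_names refl step]:
  assumes "t \<in> component A s" and "P s"
    and "\<And>a b. a \<in> A \<Longrightarrow> b \<in> A \<Longrightarrow> adjacent a b \<Longrightarrow> P a \<Longrightarrow> P b"
  shows "P t"
proof -
  have "(s, t) \<in> {(a, b). a \<in> A \<and> b \<in> A \<and> adjacent a b}\<^sup>*"
    using assms(1) by (simp add: component_def)
  then show ?thesis
    by induction (use assms(2,3) in auto)
qed

lemma component_eq:
  assumes "a \<in> A" "b \<in> A" "adjacent a b"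
  shows "component A a = component A b"
proof -
  let ?r = "{(a, b). a \<in> A \<and> b \<in> A \<and> adjacent a b}"
  have "(a, b) \<in> ?r" "(b, a) \<in> ?r"
    using assms adjacent_sym by auto
  then show ?thesis
    unfolding component_def by (auto intro: converse_rtrancl_into_rtrancl)
qed

lemma component_path:
  assumes "t \<in> component A s" "s \<in> A"
  obtains ss where "ss \<noteq> []" "set ss \<subseteq> A" "successively adjacent ss" "hd ss = s" "last ss = t"
proof -
  have "\<exists>ss. ss \<noteq> [] \<and> set ss \<subseteq> A \<and> successively adjacent ss \<and> hd ss = s \<and> last ss = t"
    using assms(1)
  proof (induction rule: component_induct)
    case refl
    then show ?case using \<open>s \<in> A\<close> by (intro exI[of _ "[s]"]) auto
  next
    case (step a b)
    then obtain ss where "ss \<noteq> []" "set ss \<subseteq> A" "successively adjacent ss" "hd ss = s" "last ss = a"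
      by blast
    with step show ?case
      by (intro exI[of _ "ss @ [b]"]) (auto simp: successively_append_iff)
  qed
  then show thesis using that by blast
qed

text \<open>Fix a root r. An outward walk from r to s followed by any return walk is a cycle, so the
  sum along the return walk depends on s only. Prefixing s to a return walk from t changes the sum
  by exactly \<open>g s t\<close>, and no walk ever has to be reversed.\<close>

lemma ex_potential:
  assumes "connected_squares R" and cycle: "\<And>ss. square_cycle R ss \<Longrightarrow> path_sum g ss = 0"
  obtains H where "\<And>s t. s \<in> R \<Longrightarrow> t \<in> R \<Longrightarrow> adjacent s t \<Longrightarrow> H t - H s = g s t"
proof (cases "R = {}")
  case False
  then obtain r where r: "r \<in> R" by blast
  define walk where "walk s t ss \<longleftrightarrow>
    ss \<noteq> [] \<and> set ss \<subseteq> R \<and> successively adjacent ss \<and> hd ss = s \<and> last ss = t" for s t ss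
  have walk: "\<exists>ss. walk s t ss" if "s \<in> R" "t \<in> R" for s t
    using component_path[of t R s] assms(1) that
    unfolding connected_squares_def walk_def by metis
  have join: "path_sum g ss + path_sum g ts = 0" if ss: "walk r s ss" and ts: "walk s r ts" for s ss ts
  proof -
    obtain us where us: "ss = us @ [s]"
      using ss unfolding walk_def by (metis append_butlast_last_id)
    obtain vs where vs: "ts = s # vs"
      using ts unfolding walk_def by (metis list.collapse)
    have "square_cycle R (us @ s # vs)"
      using ss ts unfolding us vs walk_def square_cycle_def
      by (cases us) (auto simp: successively_append_iff successively_Cons hd_append split: if_splits)
    then show ?thesis
      using cycle path_sum_append[of g us s vs] us vs by simp
  qed
  define H where "H s = path_sum g (SOME ss. walk r s ss)" for s
  have H: "H s = - path_sum g ts" if "s \<in> R" "walk s r ts" for s ts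
    using join[OF someI_ex[OF walk[OF r that(1)]] that(2)] by (simp add: H_def)
  show thesis
  proof (rule that[of H])
    fix s t assume st: "s \<in> R" "t \<in> R" "adjacent s t"
    obtain ts where ts: "walk t r ts"
      using walk st r by blast
    have "walk s r (s # ts)"
      using ts st by (auto simp: walk_def successively_Cons)
    moreover have "path_sum g (s # ts) = g s t + path_sum g ts"
      using ts by (cases ts) (auto simp: walk_def)
    ultimately show "H t - H s = g s t"
      using H[OF st(1), of "s # ts"] H[OF st(2) ts] by simp
  qed
qed (use that in blast)

section \<open>Winding numbers of square cycles\<close>

definition grid_point :: "point \<Rightarrow> complex" where
  "grid_point p = Complex (of_int (fst p)) (of_int (snd p))"

text \<open>The signed number of times a step from s to t crosses the ray going west from p.\<close>

definition crossing :: "point \<Rightarrow> square \<Rightarrow> square \<Rightarrow> int" where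
  "crossing p s t =
     (if fst s < fst p \<and> fst t = fst s then
        (if snd s = snd p \<and> snd t = snd p - 1 then 1
         else if snd s = snd p - 1 \<and> snd t = snd p then -1 else 0)
      else 0)"

lemma segment_centers:
  assumes "z \<in> closed_segment (center s) (center t)"
  obtains u where "0 \<le> u" "u \<le> 1"
    "Re z = of_int (fst s) + 1/2 + u * of_int (fst t - fst s)"
    "Im z = of_int (snd s) + 1/2 + u * of_int (snd t - snd s)"
proof -
  obtain u where u: "0 \<le> u" "u \<le> 1" "z = (1 - u) *\<^sub>R center s + u *\<^sub>R center t"
    using assms by (auto simp: in_segment)
  show thesis
    by (rule that[OF u(1,2)]) (auto simp: u(3) center_def algebra_simps)
qed

lemma half_integer_ne: "of_int a + 1 / 2 \<noteq> (of_int b :: real)"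
proof
  assume "of_int a + 1 / 2 = (of_int b :: real)"
  then have "of_int (2 * a + 1) = (of_int (2 * b) :: real)"
    by simp
  then have "2 * a + 1 = 2 * b"
    by linarith
  then show False
    by presburger
qed

text \<open>The ray going west from p is the branch cut of Ln(z - p), which is therefore a primitive
  along every step that avoids the ray. A step that crosses it is vertical and lies strictly west of
  p, where Ln(p - z) is a primitive instead.\<close>

lemma has_contour_integral_step:
  assumes "adjacent s t"
  shows "((\<lambda>w. 1 / (w - grid_point p)) has_contour_integral
    Ln (center t - grid_point p) - Ln (center s - grid_point p) +
      2 * of_real pi * \<i> * of_int (crossing p s t)) (linepath (center s) (center t))"
    (is "(?f has_contour_integral ?I) ?l")
proof -
  let ?z = "grid_point p" and ?S = "closed_segment (center s) (center t)"
  show ?thesis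
  proof (cases "crossing p s t = 0")
    case True
    have nonpos: "w - ?z \<notin> \<real>\<^sub>\<le>\<^sub>0" if w: "w \<in> ?S" for w
    proof
      assume "w - ?z \<in> \<real>\<^sub>\<le>\<^sub>0"
      then have im: "Im w = of_int (snd p)" and re: "Re w \<le> of_int (fst p)"
        by (auto simp: complex_nonpos_Reals_iff grid_point_def)
      obtain u where u: "0 \<le> u" "u \<le> 1"
        "Re w = of_int (fst s) + 1/2 + u * of_int (fst t - fst s)"
        "Im w = of_int (snd s) + 1/2 + u * of_int (snd t - snd s)"
        using segment_centers[OF w] .
      show False
        using \<open>adjacent s t\<close>
      proof (cases rule: adjacent_cases)
        case 1
        then show ?thesis using u im half_integer_ne[of "snd s" "snd p"] by simp
      next
        case 2
        then have "snd t = snd s" by (metis snd_conv)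
        then show ?thesis using u im half_integer_ne[of "snd s" "snd p"] by simp
      next
        case 3
        then have t: "fst t = fst s" "snd t = snd s + 1" by simp_all
        then have "of_int (snd p) = of_int (snd s) + 1/2 + u" "of_int (fst s) + 1/2 \<le> (of_int (fst p) :: real)"
          using u im re by simp_all
        then have "snd s = snd p - 1" "fst s < fst p"
          using u by linarith+
        then show ?thesis using True t by (simp add: crossing_def)
      next
        case 4
        then have t: "fst s = fst t" "snd s = snd t + 1" by (metis fst_conv, metis snd_conv)
        then have "of_int (snd p) = of_int (snd t) + 3/2 - u" "of_int (fst s) + 1/2 \<le> (of_int (fst p) :: real)"
          using u im re by (simp_all add: algebra_simps)
        then have "snd t = snd p - 1" "fst s < fst p"
          using u by linarith+
        then show ?thesis using True t by (simp add: crossing_def)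
      qed
    qed
    have "((\<lambda>w. Ln (w - ?z)) has_field_derivative 1 / (w - ?z)) (at w within ?S)"
      if "w \<in> ?S" for w
      using nonpos[OF that] by (auto intro!: derivative_eq_intros simp: inverse_eq_divide)
    from contour_integral_primitive[OF this, of ?l] show ?thesis
      using True by simp
  next
    case False
    then have *: "fst s < fst p" "fst t = fst s"
      "snd s = snd p \<and> snd t = snd p - 1 \<or> snd s = snd p - 1 \<and> snd t = snd p"
      by (auto simp: crossing_def split: if_splits)
    have pos: "?z - w \<notin> \<real>\<^sub>\<le>\<^sub>0" if w: "w \<in> ?S" for w
    proof -
      have "Re w = of_int (fst s) + 1/2"
        using segment_centers[OF w] *(2) by (metis add.right_neutral diff_self mult_zero_right of_int_0)
      moreover have "of_int (fst s) + 1 \<le> (of_int (fst p) :: real)"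
        using *(1) by linarith
      ultimately show ?thesis
        by (auto simp: complex_nonpos_Reals_iff grid_point_def)
    qed
    have "((\<lambda>w. Ln (?z - w)) has_field_derivative 1 / (w - ?z)) (at w within ?S)"
      if "w \<in> ?S" for w
    proof -
      have "?z - w \<noteq> 0" using pos[OF that] by auto
      then show ?thesis
        using pos[OF that] by (auto intro!: derivative_eq_intros simp: field_simps)
    qed
    from contour_integral_primitive[OF this, of ?l]
    have "(?f has_contour_integral Ln (?z - center t) - Ln (?z - center s)) ?l"
      by simp
    moreover have "Ln (?z - center t) - Ln (?z - center s) = ?I"
    proof -
      \<comment> \<open>One endpoint lies above the ray and the other below it, so
        \<open>Ln_minus\<close> shifts the two logarithms by pi i in opposite directions. Their
        difference gives 2 pi i with the sign of the crossing.\<close>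
      have ne: "center t - ?z \<noteq> 0" "center s - ?z \<noteq> 0"
        using pos[of "center t"] pos[of "center s"] by auto
      from Ln_minus[OF ne(1)] Ln_minus[OF ne(2)] show ?thesis
        using * unfolding minus_diff_eq by (auto simp: center_def grid_point_def crossing_def)
    qed
    ultimately show ?thesis by simp
  qed
qed

lemma path_center_path:
  "ss \<noteq> [] \<Longrightarrow> valid_path (center_path ss) \<and>
    pathstart (center_path ss) = center (hd ss) \<and> pathfinish (center_path ss) = center (last ss)"
  by (induction ss rule: center_path.induct) auto

text \<open>The logarithms telescope. For a closed cycle only 2 pi i times the crossing count
  remains, so that count is the winding number around p.\<close>

lemma has_contour_integral_center_path:
  assumes "ss \<noteq> []" "successively adjacent ss"
  shows "((\<lambda>w. 1 / (w - grid_point p)) has_contour_integral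
    Ln (center (last ss) - grid_point p) - Ln (center (hd ss) - grid_point p) +
      2 * of_real pi * \<i> * of_int (path_sum (crossing p) ss)) (center_path ss)"
  using assms
proof (induction ss rule: center_path.induct)
  case (1 s t ss)
  have "((\<lambda>w. 1 / (w - grid_point p)) has_contour_integral
      (Ln (center t - grid_point p) - Ln (center s - grid_point p) +
        2 * of_real pi * \<i> * of_int (crossing p s t)) +
      (Ln (center (last (t # ss)) - grid_point p) - Ln (center t - grid_point p) +
        2 * of_real pi * \<i> * of_int (path_sum (crossing p) (t # ss))))
      (linepath (center s) (center t) +++ center_path (t # ss))"
    using 1 path_center_path[of "t # ss"]
    by (intro has_contour_integral_join has_contour_integral_step) auto
  then show ?case
    by (simp add: algebra_simps)
qed (auto intro: has_contour_integral_trivial)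

lemma path_image_center_path:
  assumes "z \<in> path_image (center_path ss)" "ss \<noteq> []" "successively adjacent ss"
  shows "\<exists>s\<in>set ss. \<exists>t\<in>set ss. (s = t \<or> adjacent s t) \<and> z \<in> closed_segment (center s) (center t)"
  using assms
proof (induction ss rule: center_path.induct)
  case (1 s t ss)
  then show ?case
    using path_center_path[of "t # ss"] by (auto simp: path_image_join)
qed auto

text \<open>
  A segment from a grid point to the center of an incident square meets the grid lines through
  the centers at that center only.
\<close>

lemma corner_segment_disjoint:
  assumes "p \<in> corners s" "set ss \<subseteq> R" "s \<notin> R" "ss \<noteq> []" "successively adjacent ss"
  shows "closed_segment (grid_point p) (center s) \<inter> path_image (center_path ss) = {}"
proof (rule ccontr)
  assume "\<not> ?thesis"
  then obtain z where z: "z \<in> closed_segment (grid_point p) (center s)"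
    "z \<in> path_image (center_path ss)" by blast
  obtain a b where ab: "a \<in> set ss" "b \<in> set ss" "a = b \<or> adjacent a b"
    "z \<in> closed_segment (center a) (center b)"
    using path_image_center_path[OF z(2) assms(4,5)] by blast
  obtain r where r: "0 \<le> r" "r \<le> 1" "z = (1 - r) *\<^sub>R grid_point p + r *\<^sub>R center s"
    using z(1) by (auto simp: in_segment)
  have rez: "Re z = of_int (fst p) + r * (of_int (fst s - fst p) + 1/2)"
    and imz: "Im z = of_int (snd p) + r * (of_int (snd s - snd p) + 1/2)"
    by (auto simp: r(3) grid_point_def center_def algebra_simps)
  have d: "fst s - fst p \<in> {0, -1}" "snd s - snd p \<in> {0, -1}"
    using assms(1) by (auto simp: corners_def)
  \<comment> \<open>A coordinate of a point on the segment moves from an integer by at most 1/2, so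
    it is a half-integer at the very end or not at all.\<close>
  have r1: "r = 1" if "of_int q + r * (of_int e + 1/2) = of_int k + (1/2 :: real)" "e \<in> {0, -1}" for q e k
  proof (rule ccontr)
    assume "r \<noteq> 1"
    then have "r < 1" using r by simp
    show False
    proof (cases "e = 0")
      case True
      then have "of_int (q - k) = (1 - r) / 2" using that by (simp add: field_simps)
      then have "0 < (of_int (q - k) :: real)" "of_int (q - k) < (1 :: real)"
        using r \<open>r < 1\<close> by auto
      then show False
        unfolding of_int_0_less_iff of_int_less_1_iff by linarith
    next
      case False
      then have "of_int (q - k) = (1 + r) / 2" using that by (simp add: field_simps)
      then have "0 < (of_int (q - k) :: real)" "of_int (q - k) < (1 :: real)"
        using r \<open>r < 1\<close> by auto
      then show False
        unfolding of_int_0_less_iff of_int_less_1_iff by linarith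
    qed
  qed
  obtain u where u: "0 \<le> u" "u \<le> 1"
    "Re z = of_int (fst a) + 1/2 + u * of_int (fst b - fst a)"
    "Im z = of_int (snd a) + 1/2 + u * of_int (snd b - snd a)"
    using segment_centers[OF ab(4)] .
  have "fst a = fst b \<and> \<bar>snd b - snd a\<bar> \<le> 1 \<or> snd a = snd b \<and> \<bar>fst b - fst a\<bar> \<le> 1"
    using ab(3) by (auto simp: adjacent_def)
  then have "r = 1"
    using r1[of "fst p" "fst s - fst p" "fst a"] r1[of "snd p" "snd s - snd p" "snd a"] rez imz u d
    by auto
  then have z_s: "Re z = of_int (fst s) + 1/2" "Im z = of_int (snd s) + 1/2"
    using rez imz by (simp_all add: algebra_simps)
  \<comment> \<open>On a step between neighbouring centers only the two endpoints are centers of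
    squares.\<close>
  have mid: "k = l \<or> k = m"
    if "of_int k = of_int l + u * of_int (m - l)" "\<bar>m - l\<bar> \<le> 1" for k l m :: int
  proof -
    have "m - l = 0 \<or> m - l = 1 \<or> m - l = -1" using that by linarith
    then show ?thesis
      using that(1) u(1,2) by (elim disjE; simp; linarith)
  qed
  have "s = a \<or> s = b"
    using \<open>fst a = fst b \<and> _ \<or> _\<close>
  proof
    assume *: "fst a = fst b \<and> \<bar>snd b - snd a\<bar> \<le> 1"
    then have "snd s = snd a \<or> snd s = snd b" "fst s = fst a"
      using mid[of "snd s" "snd a" "snd b"] u z_s by auto
    then show ?thesis using * by (auto simp: prod_eq_iff)
  next
    assume *: "snd a = snd b \<and> \<bar>fst b - fst a\<bar> \<le> 1"
    then have "fst s = fst a \<or> fst s = fst b" "snd s = snd a"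
      using mid[of "fst s" "fst a" "fst b"] u z_s by auto
    then show ?thesis using * by (auto simp: prod_eq_iff)
  qed
  then show False using ab assms by blast
qed

text \<open>The winding number is constant on the segment from p to the center of s, since the cycle
  avoids it, and simple connectivity makes it 0 at the center.\<close>

lemma path_sum_crossing_eq_0:
  assumes R: "simply_connected_region R" and ss: "square_cycle R ss"
    and p: "p \<in> corners s" "s \<notin> R"
  shows "path_sum (crossing p) ss = 0"
proof -
  have ss': "ss \<noteq> []" "set ss \<subseteq> R" "successively adjacent ss" "hd ss = last ss"
    using ss by (auto simp: square_cycle_def)
  let ?\<gamma> = "center_path ss"
  have \<gamma>: "valid_path ?\<gamma>" "pathfinish ?\<gamma> = pathstart ?\<gamma>"
    using path_center_path[of ss] ss' by auto
  have disj: "closed_segment (grid_point p) (center s) \<inter> path_image ?\<gamma> = {}"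
    using corner_segment_disjoint[of p s ss R] ss' p by blast
  have "winding_number ?\<gamma> (grid_point p) = winding_number ?\<gamma> (center s)"
    using \<gamma> disj
    by (intro winding_number_eq[of _ _ "closed_segment (grid_point p) (center s)"])
      (auto intro: valid_path_imp_path)
  also have "\<dots> = 0"
    using R ss p(2) unfolding simply_connected_region_def by blast
  finally have "winding_number ?\<gamma> (grid_point p) = 0" .
  moreover have "grid_point p \<notin> path_image ?\<gamma>"
    using disj by auto
  ultimately have "contour_integral ?\<gamma> (\<lambda>w. 1 / (w - grid_point p)) = 0"
    using winding_number_valid_path[OF \<gamma>(1)] by simp
  with contour_integral_unique[OF has_contour_integral_center_path[OF ss'(1,3), of p]] ss'(4)
  show ?thesis by simp
qed

section \<open>A discrete Stokes theorem\<close>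

text \<open>Squares act as the vertices of the dual lattice: \<open>a\<close> and \<open>b\<close>
  are the values of an antisymmetric 1-cochain on steps east and north. Accordingly
  \<open>curl\<close> is its counterclockwise circulation through the four squares around a grid
  point.\<close>

definition flow :: "(square \<Rightarrow> int) \<Rightarrow> (square \<Rightarrow> int) \<Rightarrow> square \<Rightarrow> square \<Rightarrow> int" where
  "flow a b s t =
     (if t = (fst s + 1, snd s) then a s
      else if s = (fst t + 1, snd t) then - a t
      else if t = (fst s, snd s + 1) then b s
      else if s = (fst t, snd t + 1) then - b t
      else 0)"

definition curl :: "(square \<Rightarrow> int) \<Rightarrow> (square \<Rightarrow> int) \<Rightarrow> point \<Rightarrow> int" where
  "curl a b = (\<lambda>(x, y). a (x - 1, y - 1) + b (x, y - 1) - a (x - 1, y) - b (x - 1, y - 1))"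

text \<open>The step meets the westward rays of exactly those grid points that lie east of it at
  height y + 1. It passes clockwise around them, hence the minus sign.\<close>

lemma sum_crossing_up:
  assumes "-M \<le> x" "x < M" "-M \<le> y" "y < M"
  shows "(\<Sum>p\<in>{-M..M} \<times> {-M..M}. c p * crossing p (x, y) (x, y + 1)) = - (\<Sum>k\<in>{x+1..M}. c (k, y + 1))"
proof -
  have "(\<Sum>p\<in>{-M..M} \<times> {-M..M}. c p * crossing p (x, y) (x, y + 1)) =
      (\<Sum>p\<in>{x+1..M} \<times> {y+1}. c p * crossing p (x, y) (x, y + 1))"
    using assms by (intro sum.mono_neutral_right) (auto simp: crossing_def)
  also have "\<dots> = (\<Sum>p\<in>{x+1..M} \<times> {y+1}. - c p)"
    by (intro sum.cong) (auto simp: crossing_def)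
  also have "\<dots> = - (\<Sum>k\<in>{x+1..M}. c (k, y + 1))"
    by (simp add: sum.cartesian_product' sum_negf)
  finally show ?thesis .
qed

text \<open>Subtracting the gradient of P, which is invisible to closed sums, removes the horizontal
  part of the flow. What is left on a vertical step is a sum of curls over the grid points to its
  east, and these are the points whose westward rays the step crosses.\<close>

lemma discrete_Stokes:
  assumes M: "\<And>y. a (M, y) = 0" "\<And>y. b (M, y) = 0"
    and ss: "set ss \<subseteq> {-M..<M} \<times> {-M..<M}" "successively adjacent ss" "ss \<noteq> []" "hd ss = last ss"
  shows "path_sum (flow a b) ss = (\<Sum>p\<in>{-M..M} \<times> {-M..M}. curl a b p * path_sum (crossing p) ss)"
proof -
  let ?B = "{-M..M} \<times> {-M..M}"
  \<comment> \<open>Summing from the east makes P vanish in column M, where the downward induction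
    on x in \<open>D\<close> starts.\<close>
  define P where "P s = - (\<Sum>k\<in>{fst s..<M}. a (k, snd s))" for s :: square
  have P: "P (x + 1, y) - P (x, y) = a (x, y)" if "x < M" for x y
  proof -
    have "{x..<M} = insert x {x+1..<M}" using that by auto
    then show ?thesis by (simp add: P_def)
  qed
  have D: "b (x, y) = P (x, y + 1) - P (x, y) - (\<Sum>k\<in>{x+1..M}. curl a b (k, y + 1))"
    if "x \<le> M" for x y
    using that
  proof (induction x rule: int_le_induct)
    case base
    show ?case using M by (simp add: P_def)
  next
    case (step x)
    have "{x..M} = insert x {x+1..M}" using step by auto
    then show ?case
      using step P[of "x - 1" y] P[of "x - 1" "y + 1"] by (simp add: curl_def)
  qed
  have up: "flow a b (x, y) (x, y + 1) =
      P (x, y + 1) - P (x, y) + (\<Sum>p\<in>?B. curl a b p * crossing p (x, y) (x, y + 1))"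
    if "(x, y) \<in> {-M..<M} \<times> {-M..<M}" for x y
    using that D[of x y] sum_crossing_up[of M x y "curl a b"] by (simp add: flow_def)
  have neg: "flow a b s t = - flow a b t s" "crossing p s t = - crossing p t s" for s t p
    by (cases s; cases t; auto simp: flow_def crossing_def)+
  have step: "flow a b s t = P t - P s + (\<Sum>p\<in>?B. curl a b p * crossing p s t)"
    if "s \<in> {-M..<M} \<times> {-M..<M}" "t \<in> {-M..<M} \<times> {-M..<M}" "adjacent s t" for s t
    using that(3)
  proof (cases rule: adjacent_cases)
    case 1
    then show ?thesis using that P[of "fst s" "snd s"]
      by (cases s) (auto simp: flow_def crossing_def)
  next
    case 2
    then show ?thesis using that P[of "fst t" "snd t"]
      by (cases t) (auto simp: flow_def crossing_def)
  next
    case 3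
    then show ?thesis using that up[of "fst s" "snd s"] by simp
  next
    case 4
    then have "flow a b t s = P s - P t + (\<Sum>p\<in>?B. curl a b p * crossing p t s)"
      using that up[of "fst t" "snd t"] by (metis prod.collapse)
    then show ?thesis
      unfolding neg[where s = s and t = t] by (simp add: sum_negf)
  qed
  have "path_sum (flow a b) ss = P (last ss) - P (hd ss) + (\<Sum>p\<in>?B. curl a b p * path_sum (crossing p) ss)"
    using ss(1-3)
  proof (induction ss rule: center_path.induct)
    case (1 s t ss)
    then show ?case
      using step[of s t] by (auto simp: distrib_left sum.distrib)
  qed auto
  then show ?thesis using ss(4) by simp
qed

section \<open>Potentials of balanced edge functions\<close>

text \<open>
  An edge is encoded by the squares of lower and of higher level that it separates. If F gives the
  increments along the edges, then F is balanced at s iff the increments around s add up to 0.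
\<close>

definition balanced :: "(square \<Rightarrow> square \<Rightarrow> int) \<Rightarrow> square \<Rightarrow> bool" where
  "balanced F s \<longleftrightarrow>
     F (fst s - 1, snd s) s + F (fst s, snd s - 1) s =
     F s (fst s + 1, snd s) + F s (fst s, snd s + 1)"

text \<open>The increment from the lower left corner of s, which is the point s itself, to its corner p.\<close>

definition offset :: "(square \<Rightarrow> square \<Rightarrow> int) \<Rightarrow> square \<Rightarrow> point \<Rightarrow> int" where
  "offset F s p =
     (if p = s then 0
      else if p = (fst s + 1, snd s) then F (fst s, snd s - 1) s
      else if p = (fst s, snd s + 1) then - F (fst s - 1, snd s) s
      else F (fst s, snd s - 1) s - F s (fst s + 1, snd s))"

text \<open>\<open>offset\<close> reaches the upper right corner through the lower right one;
  balance says that the route through the upper left corner gives the same value.\<close>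

lemma offset_edge:
  assumes "grid_edge p q lo hi" "s \<in> {lo, hi}" "balanced F s"
  shows "offset F s q - offset F s p = F lo hi"
  using assms by (cases rule: grid_edge.cases) (auto simp: offset_def balanced_def)

lemma grid_edge_in_corners:
  "grid_edge p q lo hi \<Longrightarrow> s \<in> {lo, hi} \<Longrightarrow> p \<in> corners s \<and> q \<in> corners s"
  by (auto elim!: grid_edge.cases simp: corners_def)

text \<open>The flow is the change of height at the lower left corner when passing to a neighbouring
  square: along the bottom edge for a step east, up the left edge for a step north. At a grid point
  with all four squares in R its curl is the balance equation of the square to the lower left; at
  any other grid point the crossing count is 0.\<close>

lemma square_path_sum_eq_0:
  assumes R: "simply_connected_region R" and F: "\<And>s. s \<in> R \<Longrightarrow> balanced F s"
    and a: "a = (\<lambda>(x, y). if (x, y) \<in> R \<and> (x + 1, y) \<in> R then F (x, y - 1) (x, y) else 0)"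
    and b: "b = (\<lambda>(x, y). if (x, y) \<in> R \<and> (x, y + 1) \<in> R then - F (x - 1, y) (x, y) else 0)"
    and ss: "square_cycle R ss"
  shows "path_sum (flow a b) ss = 0"
proof -
  have "finite R"
    using R by (simp add: simply_connected_region_def region_def)
  \<comment> \<open>The summand 1 keeps column M outside R, so that \<open>a\<close> and
    \<open>b\<close> vanish there as the Stokes theorem requires.\<close>
  define M where "M = Max (insert 0 ((\<lambda>s. \<bar>fst s\<bar>) ` R \<union> (\<lambda>s. \<bar>snd s\<bar>) ` R)) + 1"
  have "\<bar>fst s\<bar> < M \<and> \<bar>snd s\<bar> < M" if "s \<in> R" for s
    using \<open>finite R\<close> that unfolding M_def zless_add1_eq
    by (auto intro!: Max_ge simp flip: le_less)
  then have M: "-M < fst s" "fst s < M" "-M < snd s" "snd s < M" if "s \<in> R" for s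
    using that by (auto simp: abs_less_iff minus_less_iff)
  have notin: "(M, y) \<notin> R" for y
    using M(2)[of "(M, y)"] by auto
  have "R \<subseteq> {-M..<M} \<times> {-M..<M}"
    using M by (fastforce simp: mem_Times_iff less_imp_le)
  then have "path_sum (flow a b) ss = (\<Sum>p\<in>{-M..M} \<times> {-M..M}. curl a b p * path_sum (crossing p) ss)"
    using ss notin by (intro discrete_Stokes) (auto simp: a b square_cycle_def)
  also have "\<dots> = 0"
  proof (rule sum.neutral, rule ballI)
    fix p :: point
    obtain x y where p: "p = (x, y)" by (cases p)
    let ?S = "{(x - 1, y - 1), (x, y - 1), (x - 1, y), (x, y)}"
    show "curl a b p * path_sum (crossing p) ss = 0"
    proof (cases "?S \<subseteq> R")
      case True
      then have "curl a b p = 0"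
        using F[of "(x - 1, y - 1)"] by (simp add: curl_def a b p balanced_def)
      then show ?thesis by simp
    next
      case False
      then obtain s where "s \<in> ?S" "s \<notin> R" by blast
      moreover have "p \<in> corners s"
        using \<open>s \<in> ?S\<close> by (auto simp: p corners_def)
      ultimately show ?thesis
        using path_sum_crossing_eq_0[OF R ss] by simp
    qed
  qed
  finally show ?thesis .
qed

lemma ex_vertex_potential:
  assumes R: "simply_connected_region R" and F: "\<And>s. s \<in> R \<Longrightarrow> balanced F s"
  shows "\<exists>h :: vertex \<Rightarrow> int. \<forall>lo hi v w. region_edge R lo hi v w \<longrightarrow> h w - h v = F lo hi"
proof -
  define a where a: "a = (\<lambda>(x, y). if (x, y) \<in> R \<and> (x + 1, y) \<in> R then F (x, y - 1) (x, y) else 0)"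
  define b where b: "b = (\<lambda>(x, y). if (x, y) \<in> R \<and> (x, y + 1) \<in> R then - F (x - 1, y) (x, y) else 0)"
  have "connected_squares R"
    using R by (simp add: simply_connected_region_def region_def)
  then obtain H where H: "\<And>s t. s \<in> R \<Longrightarrow> t \<in> R \<Longrightarrow> adjacent s t \<Longrightarrow> H t - H s = flow a b s t"
    using ex_potential[of R "flow a b"] square_path_sum_eq_0[OF R F a b] by metis
  have right: "H s + offset F s p = H t + offset F t p"
    if "s \<in> R" "t \<in> R" "t = (fst s + 1, snd s)" "p \<in> corners s" "p \<in> corners t" for s t p
  proof -
    have "H t - H s = F (fst s, snd s - 1) s"
      using H[of s t] that by (cases s) (auto simp: flow_def a adjacent_def)
    then show ?thesis
      using that by (cases s) (auto simp: offset_def corners_def)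
  qed
  have up: "H s + offset F s p = H t + offset F t p"
    if "s \<in> R" "t \<in> R" "t = (fst s, snd s + 1)" "p \<in> corners s" "p \<in> corners t" for s t p
  proof -
    have "H t - H s = - F (fst s - 1, snd s) s"
      using H[of s t] that by (cases s) (auto simp: flow_def b adjacent_def)
    then show ?thesis
      using that F[of s] by (cases s) (auto simp: offset_def corners_def balanced_def)
  qed
  have agree: "H s + offset F s p = H t + offset F t p"
    if "s \<in> squares_at R p" "t \<in> squares_at R p" "adjacent s t" for s t p
    using that(3)
    by (cases rule: adjacent_cases) (use that right up in \<open>auto simp: squares_at_def\<close>)
  \<comment> \<open>Any square representing the vertex may be chosen: two of them lie in one
    component of the squares at the point, and \<open>agree\<close> propagates along that
    component.\<close>
  define h :: "vertex \<Rightarrow> int" where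
    "h v = (let s = SOME s. s \<in> R \<and> fst v \<in> corners s \<and> v = vertex_at R (fst v) s
            in H s + offset F s (fst v))" for v
  have h: "h (vertex_at R p s) = H s + offset F s p" if "s \<in> R" "p \<in> corners s" for s p
  proof -
    define t where "t = (SOME t. t \<in> R \<and> p \<in> corners t \<and> vertex_at R p s = vertex_at R p t)"
    have t: "t \<in> R \<and> p \<in> corners t \<and> vertex_at R p s = vertex_at R p t"
      unfolding t_def by (rule someI[of _ s]) (use that in simp)
    then have "t \<in> component (squares_at R p) s"
      using component_refl[of t "squares_at R p"] by (simp add: vertex_at_def)
    then have "H s + offset F s p = H t + offset F t p"
      by (induction rule: component_induct) (simp_all add: agree)
    then show ?thesis
      by (simp add: h_def t_def vertex_at_def Let_def)
  qed
  have "h w - h v = F lo hi" if edge: "region_edge R lo hi v w" for lo hi v w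
  proof -
    obtain p q s where *: "grid_edge p q lo hi" "s \<in> R \<inter> {lo, hi}"
      "v = vertex_at R p s" "w = vertex_at R q s"
      using edge unfolding region_edge_def by blast
    then show ?thesis
      using h grid_edge_in_corners[OF *(1)] offset_edge[OF *(1), of s F] F by auto
  qed
  then show ?thesis by blast
qed

section \<open>Vertices and edges seen from the squares of the region\<close>

lemma vertex_at_eq:
  assumes "s \<in> R" "t \<in> R" "adjacent s t" "p \<in> corners s" "p \<in> corners t"
  shows "vertex_at R p s = vertex_at R p t"
  using component_eq[of s "squares_at R p" t] assms by (simp add: vertex_at_def squares_at_def)

lemma region_edgeI:
  "grid_edge p q lo hi \<Longrightarrow> s \<in> R \<Longrightarrow> s = lo \<or> s = hi \<Longrightarrow>
    region_edge R lo hi (vertex_at R p s) (vertex_at R q s)"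
  unfolding region_edge_def by blast

text \<open>All four edges have their endpoints expressed through the same square, so differences of
  a function on vertices telescope around it.\<close>

lemma square_region_edges:
  assumes "(x, y) \<in> R"
  shows "region_edge R (x, y - 1) (x, y) (vertex_at R (x, y) (x, y)) (vertex_at R (x + 1, y) (x, y))"
    and "region_edge R (x - 1, y) (x, y) (vertex_at R (x, y + 1) (x, y)) (vertex_at R (x, y) (x, y))"
    and "region_edge R (x, y) (x, y + 1) (vertex_at R (x, y + 1) (x, y)) (vertex_at R (x + 1, y + 1) (x, y))"
    and "region_edge R (x, y) (x + 1, y) (vertex_at R (x + 1, y + 1) (x, y)) (vertex_at R (x + 1, y) (x, y))"
  using assms grid_edge.east[of x y] grid_edge.south[of x "y + 1"] grid_edge.east[of x "y + 1"]
    grid_edge.south[of "x + 1" "y + 1"]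
  by (auto intro!: region_edgeI)

text \<open>The four edges of a square link its corners, adjacent squares share a vertex, and R is
  connected. Applied to the difference of two height functions, this gives uniqueness.\<close>

lemma constant_on_vertices:
  assumes "connected_squares R"
    and edge: "\<And>lo hi v w. region_edge R lo hi v w \<Longrightarrow> d v = d w"
    and "v \<in> vertices R" "w \<in> vertices R"
  shows "d v = d w"
proof -
  have local: "d (vertex_at R p s) = d (vertex_at R s s)" if "s \<in> R" "p \<in> corners s" for s p
  proof -
    obtain x y where s: "s = (x, y)" by (cases s)
    show ?thesis
      using square_region_edges[of x y R, THEN edge] that by (auto simp: s corners_def)
  qed
  have adj: "d (vertex_at R s s) = d (vertex_at R t t)" if "s \<in> R" "t \<in> R" "adjacent s t" for s t
  proof -
    obtain p where p: "p \<in> corners s" "p \<in> corners t"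
      using \<open>adjacent s t\<close> by (cases rule: adjacent_cases; cases s; cases t)
        (auto simp: corners_def)
    then show ?thesis
      using vertex_at_eq[OF that] local that by metis
  qed
  have all: "d (vertex_at R s s) = d (vertex_at R t t)" if "s \<in> R" "t \<in> R" for s t
  proof -
    have "t \<in> component R s"
      using assms(1) that by (simp add: connected_squares_def)
    then show ?thesis
      by (induction rule: component_induct) (simp_all add: adj)
  qed
  obtain p s where v: "v = vertex_at R p s" "s \<in> R" "p \<in> corners s"
    using assms(3) by (auto simp: vertices_def)
  obtain q t where w: "w = vertex_at R q t" "t \<in> R" "q \<in> corners t"
    using assms(4) by (auto simp: vertices_def)
  show ?thesis
    unfolding v(1) w(1) local[OF v(2,3)] local[OF w(2,3)] by (rule all[OF v(2) w(2)])
qed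

lemma region_edge_vertices:
  "region_edge R lo hi v w \<Longrightarrow> v \<in> vertices R \<and> w \<in> vertices R"
  unfolding region_edge_def vertices_def using grid_edge_in_corners by blast

lemma boundary_vertices_subset: "boundary_vertices R \<subseteq> vertices R"
  using region_edge_vertices by (auto simp: boundary_vertices_def boundary_edge_def)

section \<open>Ribbon tiles\<close>

definition up_step :: "square \<Rightarrow> square \<Rightarrow> bool" where
  "up_step lo hi \<longleftrightarrow> hi = (fst lo + 1, snd lo) \<or> hi = (fst lo, snd lo + 1)"

lemma up_step_level: "up_step lo hi \<Longrightarrow> level hi = level lo + 1"
  by (auto simp: up_step_def level_def)

lemma up_step_adjacent: "up_step lo hi \<Longrightarrow> adjacent lo hi"
  by (auto simp: up_step_def adjacent_def)

lemma adjacent_up_step: "adjacent s t \<Longrightarrow> up_step s t \<or> up_step t s"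
  by (erule adjacent_cases) (auto simp: up_step_def)

lemma up_step_iff_lower: "up_step lo s \<longleftrightarrow> lo = (fst s - 1, snd s) \<or> lo = (fst s, snd s - 1)"
  by (cases s; cases lo) (auto simp: up_step_def)

lemma grid_edge_up_step: "grid_edge p q lo hi \<Longrightarrow> up_step lo hi"
  by (auto elim!: grid_edge.cases simp: up_step_def)

lemma ex_grid_edge_up_step: "up_step lo hi \<Longrightarrow> \<exists>p q. grid_edge p q lo hi"
  using ex_grid_edge[of lo hi] up_step_adjacent[of lo hi] up_step_level[of lo hi] by simp

lemma color_less: "n > 0 \<Longrightarrow> color n s < n"
  by (simp add: color_def nat_less_iff)

lemma color_eq_iff: "n > 0 \<Longrightarrow> color n s = color n t \<longleftrightarrow> int n dvd level s - level t"
  by (simp add: color_def mod_eq_dvd_iff eq_nat_nat_iff)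

lemma color_step:
  assumes "n > 0" "level hi = level lo + 1"
  shows "color n hi = (color n lo + 1) mod n"
proof -
  have "int (color n hi) = int ((color n lo + 1) mod n)"
    using assms by (simp add: color_def zmod_int mod_simps add.commute)
  then show ?thesis by simp
qed

lemma Suc_mod_eq_iff:
  assumes "(a :: nat) < n" "b < n"
  shows "(a + 1) mod n = (b + 1) mod n \<longleftrightarrow> a = b"
  using assms by (auto simp: mod_if split: if_splits)

section \<open>Levels inside a ribbon tile\<close>

lemma adjacent_level: "adjacent s t \<Longrightarrow> \<bar>level s - level t\<bar> = 1"
  by (auto simp: adjacent_def level_def)

text \<open>A discrete intermediate value argument: levels change by 1 along a walk from s to u, so
  some step climbs from the level of s to the next. In a ribbon tile, where levels are distinct,
  that step starts at s itself.\<close>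

lemma connected_squares_step_up:
  assumes "connected_squares t" "s \<in> t" "u \<in> t" "level s < level u"
  shows "\<exists>a\<in>t. \<exists>b\<in>t. adjacent a b \<and> level a = level s \<and> level b = level s + 1"
proof -
  have "u \<in> component t s"
    using assms by (simp add: connected_squares_def)
  then have "level u \<le> level s \<or> ?thesis"
  proof (induction rule: component_induct)
    case (step a b)
    then show ?case using adjacent_level[of a b] by fastforce
  qed simp
  with assms(4) show ?thesis by simp
qed

lemma connected_squares_step_down:
  assumes "connected_squares t" "s \<in> t" "u \<in> t" "level u < level s"
  shows "\<exists>a\<in>t. \<exists>b\<in>t. adjacent a b \<and> level a = level s \<and> level b = level s - 1"
proof -
  have "u \<in> component t s"
    using assms by (simp add: connected_squares_def)
  then have "level s \<le> level u \<or> ?thesis"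
  proof (induction rule: component_induct)
    case (step a b)
    then show ?case using adjacent_level[of a b] by fastforce
  qed simp
  with assms(4) show ?thesis by simp
qed

lemma ribbon_tile_inj:
  assumes "ribbon_tile n t" "n > 0" "s \<in> t" "u \<in> t" "color n s = color n u"
  shows "s = u"
proof -
  have "\<exists>!x. x \<in> t \<and> color n x = color n u"
    using assms(1) color_less[OF assms(2)] by (simp add: ribbon_tile_def)
  then show ?thesis
    using assms(3-5) by (auto elim!: ex1E)
qed

lemma ribbon_tile_level_inj:
  "ribbon_tile n t \<Longrightarrow> n > 0 \<Longrightarrow> s \<in> t \<Longrightarrow> u \<in> t \<Longrightarrow> level s = level u \<Longrightarrow> s = u"
  by (rule ribbon_tile_inj) (auto simp: color_def)

lemma ribbon_tile_up:
  assumes "ribbon_tile n t" "n > 0" "s \<in> t" "u \<in> t" "level s < level u"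
  shows "\<exists>b\<in>t. up_step s b"
proof -
  obtain a b where ab: "a \<in> t" "b \<in> t" "adjacent a b" "level a = level s" "level b = level s + 1"
    using connected_squares_step_up[of t s u] assms by (auto simp: ribbon_tile_def)
  then have "a = s"
    using ribbon_tile_level_inj assms by blast
  then show ?thesis
    using ab adjacent_up_step[of a b] up_step_level[of b a] by fastforce
qed

lemma ribbon_tile_down:
  assumes "ribbon_tile n t" "n > 0" "s \<in> t" "u \<in> t" "level u < level s"
  shows "\<exists>b\<in>t. up_step b s"
proof -
  obtain a b where ab: "a \<in> t" "b \<in> t" "adjacent a b" "level a = level s" "level b = level s - 1"
    using connected_squares_step_down[of t s u] assms by (auto simp: ribbon_tile_def)
  then have "a = s"
    using ribbon_tile_level_inj assms by blast
  then show ?thesis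
    using ab adjacent_up_step[of a b] up_step_level[of a b] by fastforce
qed

lemma ribbon_tile_levels:
  assumes "ribbon_tile n t" "n > 0" "s \<in> t" "u \<in> t" "level s \<le> k" "k \<le> level u"
  shows "\<exists>x\<in>t. level x = k"
  using assms(5,6)
proof (induction k rule: int_ge_induct)
  case base
  then show ?case using assms(3) by blast
next
  case (step k)
  then obtain x where "x \<in> t" "level x = k" by auto
  then obtain y where "y \<in> t" "up_step x y"
    using ribbon_tile_up[OF assms(1,2) _ assms(4), of x] step.prems by auto
  then show ?case
    using \<open>level x = k\<close> up_step_level[of x y] by (intro bexI[of _ y]) simp
qed

text \<open>Otherwise the tile would contain a square exactly n levels below u, which has the color
  of u.\<close>

lemma ribbon_tile_span:
  assumes "ribbon_tile n t" "n > 0" "s \<in> t" "u \<in> t"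
  shows "level u - level s < int n"
proof (rule ccontr)
  assume "\<not> ?thesis"
  then obtain x where x: "x \<in> t" "level x = level u - int n"
    using ribbon_tile_levels[OF assms, of "level u - int n"] by auto
  then have "x = u"
    using ribbon_tile_inj[OF assms(1,2), of x u] assms by (simp add: color_eq_iff)
  then show False using x \<open>n > 0\<close> by simp
qed

text \<open>Let s be the square of the color following that of the top. Its level is congruent to
  one more than the top level, and the bound on the span leaves only n - 1 levels below the top. By
  the same bound no square of the tile is lower.\<close>

lemma ex_tile_type:
  assumes t: "ribbon_tile n t" "n > 0"
  shows "\<exists>j<n. tile_type n t j"
proof -
  have "inj_on (color n) t"
    using ribbon_tile_inj[OF t] by (auto simp: inj_on_def)
  moreover have "color n ` t \<subseteq> {..<n}"
    using color_less[OF t(2)] by auto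
  ultimately have fin: "finite t"
    using inj_on_finite by blast
  have "t \<noteq> {}"
    using t by (auto simp: ribbon_tile_def)
  then have "Max (level ` t) \<in> level ` t" "Min (level ` t) \<in> level ` t"
    using fin by (simp_all add: Max_in Min_in)
  then obtain top bot where "top \<in> t" "level top = Max (level ` t)"
    and "bot \<in> t" "level bot = Min (level ` t)"
    by (metis imageE)
  then have top: "top \<in> t" "\<forall>u\<in>t. level u \<le> level top"
    and bot: "bot \<in> t" "\<forall>u\<in>t. level bot \<le> level u"
    using fin by simp_all
  have "(color n top + 1) mod n < n" using t by simp
  then obtain s where s: "s \<in> t" "color n s = (color n top + 1) mod n"
    using t unfolding ribbon_tile_def by blast
  have "color n s = color n (fst top + 1, snd top)"
    using s(2) color_step[OF t(2), of "(fst top + 1, snd top)" top] by (simp add: level_def)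
  then have "int n dvd level top + 1 - level s"
    using color_eq_iff[OF t(2), of "(fst top + 1, snd top)" s] by (simp add: level_def algebra_simps)
  then obtain k where k: "level top + 1 - level s = int n * k"
    by (auto elim: dvdE)
  have "0 < int n * k" "int n * k \<le> int n"
    using k top(2) s(1) ribbon_tile_span[OF t s(1) top(1)] by auto
  then have "k = 1"
    using \<open>n > 0\<close> mult_le_cancel_left_pos[of "int n" k 1] by (simp add: zero_less_mult_iff)
  have "level top - level bot < int n"
    using ribbon_tile_span[OF t bot(1) top(1)] .
  then have "level s \<le> level bot"
    using k \<open>k = 1\<close> by simp
  then have "\<forall>u\<in>t. level s \<le> level u"
    using bot(2) by (blast intro: order.trans)
  then have "tile_type n t (color n top)"
    unfolding tile_type_def using s top by blast
  then show ?thesis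
    using color_less[OF t(2)] by blast
qed

lemma tile_type_unique:
  assumes "tile_type n t i" "tile_type n t j"
  shows "i = j"
proof -
  obtain s u where "s \<in> t" "\<forall>x\<in>t. level x \<le> level s" "color n s = i"
    and "u \<in> t" "\<forall>x\<in>t. level x \<le> level u" "color n u = j"
    using assms by (auto simp: tile_type_def)
  then have "level s = level u" by force
  then show ?thesis
    using \<open>color n s = i\<close> \<open>color n u = j\<close> by (simp add: color_def)
qed

text \<open>Colors are distinct within a tile, so color j+1 singles out its lowest square; from
  every other square the tile continues downwards.\<close>

lemma tile_type_bottom_iff:
  assumes "ribbon_tile n t" "n > 0" "tile_type n t j" "s \<in> t"
  shows "(\<exists>b\<in>t. up_step b s) \<longleftrightarrow> color n s \<noteq> (j + 1) mod n"
proof -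
  obtain m where m: "m \<in> t" "\<forall>u\<in>t. level m \<le> level u" "color n m = (j + 1) mod n"
    using assms by (auto simp: tile_type_def)
  show ?thesis
  proof
    assume "\<exists>b\<in>t. up_step b s"
    then obtain b where "b \<in> t" "level s = level b + 1" using up_step_level by blast
    then have "s \<noteq> m" using m(2) by force
    then show "color n s \<noteq> (j + 1) mod n"
      using ribbon_tile_inj[OF assms(1,2,4) m(1)] m(3) by metis
  next
    assume "color n s \<noteq> (j + 1) mod n"
    then have "level m \<noteq> level s" using m(3) by (auto simp: color_def)
    then have "level m < level s" using m(2) assms(4) by force
    then show "\<exists>b\<in>t. up_step b s"
      using ribbon_tile_down[OF assms(1,2,4) m(1)] by blast
  qed
qed

lemma tile_type_top_iff:
  assumes "ribbon_tile n t" "n > 0" "tile_type n t j" "s \<in> t"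
  shows "(\<exists>b\<in>t. up_step s b) \<longleftrightarrow> color n s \<noteq> j"
proof -
  obtain m where m: "m \<in> t" "\<forall>u\<in>t. level u \<le> level m" "color n m = j"
    using assms by (auto simp: tile_type_def)
  show ?thesis
  proof
    assume "\<exists>b\<in>t. up_step s b"
    then obtain b where "b \<in> t" "level b = level s + 1" using up_step_level by blast
    then have "s \<noteq> m" using m(2) by force
    then show "color n s \<noteq> j"
      using ribbon_tile_inj[OF assms(1,2,4) m(1)] m(3) by metis
  next
    assume "color n s \<noteq> j"
    then have "level m \<noteq> level s" using m(3) by (auto simp: color_def)
    then have "level s < level m" using m(2) assms(4) by force
    then show "\<exists>b\<in>t. up_step s b"
      using ribbon_tile_up[OF assms(1,2,4) m(1)] by blast
  qed
qed

section \<open>The increments of a tiling\<close>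

text \<open>This is coordinate i of the prescribed increment. Testing whether i is the type of a
  common tile avoids choosing that tile or its type.\<close>

definition tiling_increment :: "nat \<Rightarrow> square set set \<Rightarrow> square \<Rightarrow> square \<Rightarrow> nat \<Rightarrow> int" where
  "tiling_increment n \<alpha> lo hi i =
     (if \<exists>t\<in>\<alpha>. lo \<in> t \<and> hi \<in> t
      then 2 * of_bool (\<exists>t\<in>\<alpha>. lo \<in> t \<and> hi \<in> t \<and> tile_type n t i) - of_bool (i = color n lo)
      else of_bool (i = color n lo))"

lemma ribbon_tiling_unique:
  assumes "\<alpha> \<in> ribbon_tilings n R" "t \<in> \<alpha>" "u \<in> \<alpha>" "s \<in> t" "s \<in> u"
  shows "t = u"
  using assms disjointD[of \<alpha> t u] by (auto simp: ribbon_tilings_def partition_on_def)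

lemma tiling_increment_tile:
  assumes "\<alpha> \<in> ribbon_tilings n R" "t \<in> \<alpha>" "tile_type n t j" "lo \<in> t" "hi \<in> t"
  shows "tiling_increment n \<alpha> lo hi i = 2 * of_bool (i = j) - of_bool (i = color n lo)"
proof -
  have "(\<exists>u\<in>\<alpha>. lo \<in> u \<and> hi \<in> u \<and> tile_type n u i) \<longleftrightarrow> i = j"
    using assms ribbon_tiling_unique[OF assms(1)] tile_type_unique by metis
  then show ?thesis
    using assms by (auto simp: tiling_increment_def)
qed

lemma tiling_increment_no_tile:
  assumes "\<not> (\<exists>t\<in>\<alpha>. lo \<in> t \<and> hi \<in> t)"
  shows "tiling_increment n \<alpha> lo hi i = of_bool (i = color n lo)"
  using assms by (auto simp: tiling_increment_def)

text \<open>The two squares below s share a color c, so an uncrossed edge into s contributes e_c. If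
  one edge crosses the tile, the e_c of the other cancels its -e_c and 2 e_j is left; if none does,
  s is the lowest square and c = j. Both cannot cross, as levels in a tile are distinct. The edges
  leaving s behave alike, with s as their lower square.\<close>

lemma balanced_tiling_increment:
  assumes "n > 0" and \<alpha>: "\<alpha> \<in> ribbon_tilings n R" and "s \<in> R"
  shows "balanced (\<lambda>lo hi. tiling_increment n \<alpha> lo hi i) s"
proof -
  obtain t where t: "t \<in> \<alpha>" "s \<in> t"
    using \<alpha> \<open>s \<in> R\<close> by (auto simp: ribbon_tilings_def partition_on_def)
  have rt: "ribbon_tile n t"
    using \<alpha> t by (auto simp: ribbon_tilings_def)
  obtain j where j: "j < n" "tile_type n t j"
    using ex_tile_type[OF rt \<open>n > 0\<close>] by blast
  let ?F = "\<lambda>lo hi. tiling_increment n \<alpha> lo hi i"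
  have F: "?F a b = (if a \<in> t \<and> b \<in> t then 2 * of_bool (i = j) - of_bool (i = color n a)
      else of_bool (i = color n a))" if "a = s \<or> b = s" for a b
    using tiling_increment_tile[OF \<alpha> t(1) j(2)] tiling_increment_no_tile[of \<alpha> a b]
      ribbon_tiling_unique[OF \<alpha> t(1)] t that by (smt (verit, best))
  let ?a = "(fst s - 1, snd s)" and ?b = "(fst s, snd s - 1)"
  let ?c = "(fst s + 1, snd s)" and ?d = "(fst s, snd s + 1)"
  have level: "level ?a = level ?b" "level ?c = level ?d" "level s = level ?a + 1"
    by (simp_all add: level_def)
  have ne: "\<not> (?a \<in> t \<and> ?b \<in> t)" "\<not> (?c \<in> t \<and> ?d \<in> t)"
    using ribbon_tile_level_inj[OF rt \<open>n > 0\<close>] level by (metis add_cancel_left_right fst_conv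
        diff_add_cancel zero_neq_one)+
  have color_ab: "color n ?a = color n ?b"
    using level by (simp add: color_def)
  have lower: "?F ?a s + ?F ?b s = 2 * of_bool (i = j)"
  proof (cases "color n s = (j + 1) mod n")
    case True
    then have "?a \<notin> t" "?b \<notin> t"
      using tile_type_bottom_iff[OF rt \<open>n > 0\<close> j(2) t(2)] by (auto simp: up_step_iff_lower)
    moreover have "color n ?a = j"
      using True color_step[OF \<open>n > 0\<close> level(3)] Suc_mod_eq_iff color_less[OF \<open>n > 0\<close>] j(1) by metis
    ultimately show ?thesis
      using color_ab by (simp add: F)
  next
    case False
    then have "?a \<in> t \<or> ?b \<in> t"
      using tile_type_bottom_iff[OF rt \<open>n > 0\<close> j(2) t(2)] by (auto simp: up_step_iff_lower)
    then show ?thesis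
      using ne(1) t(2) color_ab by (auto simp: F)
  qed
  have upper: "?F s ?c + ?F s ?d = 2 * of_bool (i = j)"
  proof (cases "color n s = j")
    case True
    then have "?c \<notin> t" "?d \<notin> t"
      using tile_type_top_iff[OF rt \<open>n > 0\<close> j(2) t(2)] by (auto simp: up_step_def)
    then show ?thesis
      using True by (simp add: F)
  next
    case False
    then have "?c \<in> t \<or> ?d \<in> t"
      using tile_type_top_iff[OF rt \<open>n > 0\<close> j(2) t(2)] by (auto simp: up_step_def)
    then show ?thesis
      using ne(2) t(2) by (auto simp: F)
  qed
  show ?thesis
    unfolding balanced_def using lower upper by simp
qed

text \<open>Tiles are connected, so the crossed edges lead from any square of a tile to all the
  others and thus determine the tile.\<close>

lemma ribbon_tilings_eqI:
  assumes \<alpha>: "\<alpha> \<in> ribbon_tilings n R" and \<beta>: "\<beta> \<in> ribbon_tilings n R"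
    and same: "\<And>lo hi. up_step lo hi \<Longrightarrow> lo \<in> R \<Longrightarrow> hi \<in> R \<Longrightarrow>
      (\<exists>t\<in>\<alpha>. lo \<in> t \<and> hi \<in> t) \<longleftrightarrow> (\<exists>t\<in>\<beta>. lo \<in> t \<and> hi \<in> t)"
  shows "\<alpha> = \<beta>"
proof -
  have sub: "t \<subseteq> u"
    if \<alpha>: "\<alpha> \<in> ribbon_tilings n R" and \<beta>: "\<beta> \<in> ribbon_tilings n R"
      and same: "\<And>lo hi. up_step lo hi \<Longrightarrow> lo \<in> R \<Longrightarrow> hi \<in> R \<Longrightarrow>
        \<exists>t\<in>\<alpha>. lo \<in> t \<and> hi \<in> t \<Longrightarrow> \<exists>t\<in>\<beta>. lo \<in> t \<and> hi \<in> t"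
      and "t \<in> \<alpha>" "u \<in> \<beta>" "s \<in> t" "s \<in> u"
    for \<alpha> \<beta> t u s
  proof
    fix x assume "x \<in> t"
    have "t \<subseteq> R" "connected_squares t"
      using \<alpha> \<open>t \<in> \<alpha>\<close> by (auto simp: ribbon_tilings_def partition_on_def ribbon_tile_def)
    then have "x \<in> component t s"
      using \<open>s \<in> t\<close> \<open>x \<in> t\<close> by (simp add: connected_squares_def)
    then show "x \<in> u"
    proof (induction rule: component_induct)
      case (step a b)
      then have "\<exists>v\<in>\<beta>. a \<in> v \<and> b \<in> v"
        using same[of a b] same[of b a] adjacent_up_step[of a b] \<open>t \<in> \<alpha>\<close> \<open>t \<subseteq> R\<close> by blast
      then show ?case
        using ribbon_tiling_unique[OF \<beta> _ \<open>u \<in> \<beta>\<close>] step by blast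
    qed fact
  qed
  have "t \<in> \<beta>"
    if \<alpha>: "\<alpha> \<in> ribbon_tilings n R" and \<beta>: "\<beta> \<in> ribbon_tilings n R"
      and same: "\<And>lo hi. up_step lo hi \<Longrightarrow> lo \<in> R \<Longrightarrow> hi \<in> R \<Longrightarrow>
        (\<exists>t\<in>\<alpha>. lo \<in> t \<and> hi \<in> t) \<longleftrightarrow> (\<exists>t\<in>\<beta>. lo \<in> t \<and> hi \<in> t)"
      and "t \<in> \<alpha>"
    for \<alpha> \<beta> t
  proof -
    have "t \<noteq> {}" "t \<subseteq> R"
      using \<alpha> \<open>t \<in> \<alpha>\<close> by (auto simp: ribbon_tilings_def partition_on_def)
    then obtain s where "s \<in> t" "s \<in> R" by blast
    then obtain u where u: "u \<in> \<beta>" "s \<in> u"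
      using \<beta> by (auto simp: ribbon_tilings_def partition_on_def)
    have "t \<subseteq> u"
      by (rule sub[OF \<alpha> \<beta> _ \<open>t \<in> \<alpha>\<close> u(1) \<open>s \<in> t\<close> u(2)]) (simp add: same)
    moreover have "u \<subseteq> t"
      by (rule sub[OF \<beta> \<alpha> _ u(1) \<open>t \<in> \<alpha>\<close> u(2) \<open>s \<in> t\<close>]) (simp add: same)
    ultimately show ?thesis using u by simp
  qed
  from this[OF \<alpha> \<beta> same] this[OF \<beta> \<alpha> same[symmetric]] show ?thesis by blast
qed

section \<open>From increments to tilings\<close>

text \<open>Conditions (2) and (3), coordinate by coordinate and with edges encoded by their two
  squares, so that vertices disappear. Balance is what remains of the fact that the increments come
  from a function on vertices.\<close>

locale local_flow =
  fixes n :: nat and R :: "square set" and F :: "square \<Rightarrow> square \<Rightarrow> nat \<Rightarrow> int"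
  assumes n_pos: "n > 0"
    and balanced: "\<And>s i. s \<in> R \<Longrightarrow> i < n \<Longrightarrow> balanced (\<lambda>lo hi. F lo hi i) s"
    and boundary: "\<And>lo hi i. up_step lo hi \<Longrightarrow> (lo \<in> R) \<noteq> (hi \<in> R) \<Longrightarrow> i < n \<Longrightarrow>
      F lo hi i = of_bool (i = color n lo)"
    and interior: "\<And>lo hi. up_step lo hi \<Longrightarrow> lo \<in> R \<Longrightarrow> hi \<in> R \<Longrightarrow>
      (\<forall>i<n. F lo hi i = of_bool (i = color n lo)) \<or>
      (\<exists>j<n. j \<noteq> color n lo \<and> (\<forall>i<n. F lo hi i = 2 * of_bool (i = j) - of_bool (i = color n lo)))"
begin

definition plain :: "square \<Rightarrow> square \<Rightarrow> bool" where
  "plain lo hi \<longleftrightarrow> (\<forall>i<n. F lo hi i = of_bool (i = color n lo))"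

definition carries :: "square \<Rightarrow> square \<Rightarrow> nat \<Rightarrow> bool" where
  "carries lo hi j \<longleftrightarrow> j < n \<and> j \<noteq> color n lo \<and>
     (\<forall>i<n. F lo hi i = 2 * of_bool (i = j) - of_bool (i = color n lo))"

definition crosses :: "square \<Rightarrow> square \<Rightarrow> bool" where
  "crosses lo hi \<longleftrightarrow> up_step lo hi \<and> (lo \<in> R \<or> hi \<in> R) \<and> \<not> plain lo hi"

lemma plain_or_carries: "up_step lo hi \<Longrightarrow> lo \<in> R \<or> hi \<in> R \<Longrightarrow> plain lo hi \<or> (\<exists>j. carries lo hi j)"
  using boundary interior unfolding plain_def carries_def by blast

lemma carries_not_plain: "carries lo hi j \<Longrightarrow> \<not> plain lo hi"
  unfolding carries_def plain_def by (intro notI) (auto dest!: spec[of _ j])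

lemma carries_unique:
  assumes "carries lo hi i" "carries lo hi j"
  shows "i = j"
proof -
  have "F lo hi i = 2 - of_bool (i = color n lo)"
    "F lo hi i = 2 * of_bool (i = j) - of_bool (i = color n lo)"
    using assms by (auto simp: carries_def)
  then show ?thesis by (auto split: if_splits)
qed

lemma crosses_in_R: "crosses lo hi \<Longrightarrow> lo \<in> R \<and> hi \<in> R"
  using boundary unfolding crosses_def plain_def by blast

lemma increment_nonneg:
  assumes "plain lo hi \<or> (\<exists>j. carries lo hi j)" "i < n" "i \<noteq> color n lo"
  shows "F lo hi i \<ge> 0"
  using assms by (auto simp: plain_def carries_def)

text \<open>This serves the two edges entering a square and the two leaving it, whose lower squares
  have a common color c. A label differs from c, so each labelled edge has coefficient -1 at c: two
  of them give -2, while one cancels the unit vector of its plain partner. A label different from c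
  also forces n \<ge> 2.\<close>

lemma pair_cases:
  assumes "plain a a' \<or> (\<exists>j. carries a a' j)" "plain b b' \<or> (\<exists>j. carries b b' j)"
    and c: "color n a = c" "color n b = c"
  obtains
    (both) "F a a' c + F b b' c = -2" "n \<ge> 2"
  | (none) "plain a a'" "plain b b'" "\<And>i. i < n \<Longrightarrow> F a a' i + F b b' i = 2 * of_bool (i = c)"
  | (fst) j where "carries a a' j" "plain b b'" "\<And>i. i < n \<Longrightarrow> F a a' i + F b b' i = 2 * of_bool (i = j)"
  | (snd) j where "plain a a'" "carries b b' j" "\<And>i. i < n \<Longrightarrow> F a a' i + F b b' i = 2 * of_bool (i = j)"
proof -
  consider "plain a a'" "plain b b'" | j where "carries a a' j" "plain b b'"
    | j where "plain a a'" "carries b b' j" | j k where "carries a a' j" "carries b b' k"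
    using assms(1,2) by blast
  then show thesis
  proof cases
    case 1
    then show ?thesis using c by (intro none) (auto simp: plain_def)
  next
    case (2 j)
    then show ?thesis using c by (intro fst[of j]) (auto simp: plain_def carries_def)
  next
    case (3 j)
    then show ?thesis using c by (intro snd[of j]) (auto simp: plain_def carries_def)
  next
    case (4 j k)
    then show ?thesis using c color_less[OF n_pos, of a]
      by (intro both) (auto simp: carries_def)
  qed
qed

text \<open>The label is the type of the tile that s is going to belong to; the last two clauses
  recognise the lowest and the highest square of that tile by color.\<close>

definition is_label :: "square \<Rightarrow> nat \<Rightarrow> bool" where
  "is_label s j \<longleftrightarrow> j < n \<and>
    (\<forall>lo. crosses lo s \<longrightarrow> carries lo s j) \<and> (\<forall>hi. crosses s hi \<longrightarrow> carries s hi j) \<and>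
    (\<forall>lo lo'. crosses lo s \<longrightarrow> crosses lo' s \<longrightarrow> lo = lo') \<and>
    (\<forall>hi hi'. crosses s hi \<longrightarrow> crosses s hi' \<longrightarrow> hi = hi') \<and>
    ((\<exists>lo. crosses lo s) \<longleftrightarrow> color n s \<noteq> (j + 1) mod n) \<and>
    ((\<exists>hi. crosses s hi) \<longleftrightarrow> color n s \<noteq> j)"

text \<open>
  If both edges entering s carried a label, the entering increments would have coefficient -2 at the
  color below s, while the leaving increments are nonnegative there; the same holds with
  entering and leaving exchanged. So both sides of the balance equation are 2 times a unit vector.
\<close>

lemma ex_label:
  assumes "s \<in> R"
  shows "\<exists>j. is_label s j"
proof -
  let ?a = "(fst s - 1, snd s)" and ?b = "(fst s, snd s - 1)"
  let ?c = "(fst s + 1, snd s)" and ?d = "(fst s, snd s + 1)"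
  have bal: "F ?a s i + F ?b s i = F s ?c i + F s ?d i" if "i < n" for i
    using balanced[OF assms that] by (simp add: balanced_def)
  have col: "color n ?b = color n ?a"
    by (simp add: color_def level_def algebra_simps)
  have cs: "color n s = (color n ?a + 1) mod n"
    by (rule color_step[OF n_pos]) (simp add: level_def)
  \<comment> \<open>Squares of consecutive levels differ in color only for n \<ge> 2, a bound that
    case \<open>both\<close> supplies. It makes the leaving increments nonnegative at the color of
    \<open>?a\<close>.\<close>
  have ne: "color n s \<noteq> color n ?a" if "n \<ge> 2"
    using that color_eq_iff[OF n_pos, of s ?a] by (simp add: level_def)
  have up: "up_step ?a s" "up_step ?b s" "up_step s ?c" "up_step s ?d"
    by (simp_all add: up_step_def)
  have pc: "plain ?a s \<or> (\<exists>j. carries ?a s j)" "plain ?b s \<or> (\<exists>j. carries ?b s j)"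
    "plain s ?c \<or> (\<exists>j. carries s ?c j)" "plain s ?d \<or> (\<exists>j. carries s ?d j)"
    using plain_or_carries up assms by blast+
  have cr_lo: "crosses lo s \<longleftrightarrow> (lo = ?a \<or> lo = ?b) \<and> \<not> plain lo s" for lo
    using assms by (auto simp: crosses_def up_step_iff_lower)
  have cr_hi: "crosses s hi \<longleftrightarrow> (hi = ?c \<or> hi = ?d) \<and> \<not> plain s hi" for hi
    using assms by (auto simp: crosses_def up_step_def)
  have "\<exists>j<n. (\<forall>i<n. F ?a s i + F ?b s i = 2 * of_bool (i = j)) \<and>
    (\<forall>lo. crosses lo s \<longrightarrow> carries lo s j) \<and>
    (\<forall>lo lo'. crosses lo s \<longrightarrow> crosses lo' s \<longrightarrow> lo = lo') \<and>
    ((\<exists>lo. crosses lo s) \<longleftrightarrow> color n ?a \<noteq> j)"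
    using pc(1,2) refl col
  proof (cases rule: pair_cases)
    case both
    then show ?thesis
      using increment_nonneg[OF pc(3), of "color n ?a"] increment_nonneg[OF pc(4), of "color n ?a"]
        bal[of "color n ?a"] ne color_less[OF n_pos, of ?a] by force
  next
    case none
    then show ?thesis
      using color_less[OF n_pos] by (intro exI[of _ "color n ?a"]) (auto simp: cr_lo)
  next
    case (fst j)
    then show ?thesis
      using carries_not_plain[OF fst(1)]
      by (intro exI[of _ j]) (auto simp: cr_lo, auto simp: carries_def)
  next
    case (snd j)
    then show ?thesis
      using carries_not_plain[OF snd(2)] col
      by (intro exI[of _ j]) (auto simp: cr_lo, auto simp: carries_def)
  qed
  then obtain j where j: "j < n" "\<forall>i<n. F ?a s i + F ?b s i = 2 * of_bool (i = j)"
    "\<forall>lo. crosses lo s \<longrightarrow> carries lo s j"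
    "\<forall>lo lo'. crosses lo s \<longrightarrow> crosses lo' s \<longrightarrow> lo = lo'"
    "(\<exists>lo. crosses lo s) \<longleftrightarrow> color n ?a \<noteq> j"
    by (elim exE conjE) (rule that; assumption)
  have "\<exists>k<n. (\<forall>i<n. F s ?c i + F s ?d i = 2 * of_bool (i = k)) \<and>
    (\<forall>hi. crosses s hi \<longrightarrow> carries s hi k) \<and>
    (\<forall>hi hi'. crosses s hi \<longrightarrow> crosses s hi' \<longrightarrow> hi = hi') \<and>
    ((\<exists>hi. crosses s hi) \<longleftrightarrow> color n s \<noteq> k)"
    using pc(3,4) refl refl
  proof (cases rule: pair_cases)
    case both
    have c: "color n s < n" by (rule color_less[OF n_pos])
    have "2 * of_bool (color n s = j) = (-2 :: int)"
      using bal[OF c] j(2)[rule_format, OF c] both(1) by simp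
    then show ?thesis
      by (cases "color n s = j") simp_all
  next
    case none
    then show ?thesis
      using color_less[OF n_pos] by (intro exI[of _ "color n s"]) (auto simp: cr_hi)
  next
    case (fst k)
    then show ?thesis
      using carries_not_plain[OF fst(1)]
      by (intro exI[of _ k]) (auto simp: cr_hi, auto simp: carries_def)
  next
    case (snd k)
    then show ?thesis
      using carries_not_plain[OF snd(2)]
      by (intro exI[of _ k]) (auto simp: cr_hi, auto simp: carries_def)
  qed
  then obtain k where k: "k < n" "\<forall>i<n. F s ?c i + F s ?d i = 2 * of_bool (i = k)"
    "\<forall>hi. crosses s hi \<longrightarrow> carries s hi k"
    "\<forall>hi hi'. crosses s hi \<longrightarrow> crosses s hi' \<longrightarrow> hi = hi'"
    "(\<exists>hi. crosses s hi) \<longleftrightarrow> color n s \<noteq> k"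
    by (elim exE conjE) (rule that; assumption)
  have "j = k"
    using j(1,2) k(2) bal[of j] by (auto split: if_splits)
  \<comment> \<open>The entering edges compare j with the color below s; shifting by one turns this
    into the test for the lowest square.\<close>
  moreover have "color n ?a \<noteq> j \<longleftrightarrow> color n s \<noteq> (j + 1) mod n"
    using cs Suc_mod_eq_iff[OF color_less[OF n_pos, of ?a] j(1)] by auto
  ultimately have "is_label s j"
    unfolding is_label_def using j(1,3,4) k(3,4) j(5) k(5)
    by (intro conjI) simp_all
  then show ?thesis by blast
qed

section \<open>Assembling linked squares into ribbon tiles\<close>

definition label :: "square \<Rightarrow> nat" where
  "label s = (SOME j. is_label s j)"

lemma label:
  assumes "s \<in> R"
  shows "label s < n" "crosses lo s \<Longrightarrow> carries lo s (label s)" "crosses s hi \<Longrightarrow> carries s hi (label s)"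
    "crosses lo s \<Longrightarrow> crosses lo' s \<Longrightarrow> lo = lo'"
    "crosses s hi \<Longrightarrow> crosses s hi' \<Longrightarrow> hi = hi'"
    "(\<exists>lo. crosses lo s) \<longleftrightarrow> color n s \<noteq> (label s + 1) mod n"
    "(\<exists>hi. crosses s hi) \<longleftrightarrow> color n s \<noteq> label s"
proof -
  have *: "is_label s (label s)"
    unfolding label_def by (rule someI_ex[OF ex_label[OF assms]])
  show "label s < n"
    using * unfolding is_label_def by (elim conjE)
  show "(\<exists>lo. crosses lo s) \<longleftrightarrow> color n s \<noteq> (label s + 1) mod n"
    using * unfolding is_label_def by (elim conjE)
  show "(\<exists>hi. crosses s hi) \<longleftrightarrow> color n s \<noteq> label s"
    using * unfolding is_label_def by (elim conjE)
  have "\<forall>lo. crosses lo s \<longrightarrow> carries lo s (label s)" "\<forall>hi. crosses s hi \<longrightarrow> carries s hi (label s)"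
    using * unfolding is_label_def by - (elim conjE, assumption)+
  then show "crosses lo s \<Longrightarrow> carries lo s (label s)" "crosses s hi \<Longrightarrow> carries s hi (label s)"
    by blast+
  have "\<forall>lo lo'. crosses lo s \<longrightarrow> crosses lo' s \<longrightarrow> lo = lo'"
    "\<forall>hi hi'. crosses s hi \<longrightarrow> crosses s hi' \<longrightarrow> hi = hi'"
    using * unfolding is_label_def by - (elim conjE, assumption)+
  then show "crosses lo s \<Longrightarrow> crosses lo' s \<Longrightarrow> lo = lo'" "crosses s hi \<Longrightarrow> crosses s hi' \<Longrightarrow> hi = hi'"
    by blast+
qed

text \<open>Both ends see their own label on the edge between them, and an edge carries only
  one.\<close>

lemma label_crosses: "crosses lo hi \<Longrightarrow> label lo = label hi"
  using label(2,3) carries_unique crosses_in_R by metis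

text \<open>The number of steps from s to the highest square of its tile.\<close>

definition steps_up :: "square \<Rightarrow> nat" where
  "steps_up s = nat ((int (label s) - level s) mod int n)"

lemma steps_up_less: "steps_up s < n"
  using n_pos by (simp add: steps_up_def nat_less_iff)

lemma int_steps_up: "int (steps_up s) = (int (label s) - level s) mod int n"
  using n_pos by (simp add: steps_up_def)

lemma steps_up_eq_0_iff:
  assumes "s \<in> R"
  shows "steps_up s = 0 \<longleftrightarrow> color n s = label s"
proof -
  have "steps_up s = 0 \<longleftrightarrow> int (steps_up s) = 0" by simp
  also have "\<dots> \<longleftrightarrow> int (label s) mod int n = level s mod int n"
    unfolding int_steps_up mod_eq_dvd_iff dvd_eq_mod_eq_0 ..
  also have "\<dots> \<longleftrightarrow> int (label s) = int (color n s)"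
    using label(1)[OF assms] n_pos by (simp add: color_def)
  finally show ?thesis by auto
qed

lemma steps_up_crosses:
  assumes "crosses lo hi"
  shows "steps_up lo = Suc (steps_up hi)"
proof -
  have "lo \<in> R" using crosses_in_R assms by blast
  \<comment> \<open>A crossed edge leaves lo, so lo is not the top of its chain; this rules out a
    wrap-around of the residue below.\<close>
  then have "steps_up lo \<noteq> 0"
    using assms label(7) steps_up_eq_0_iff by blast
  have "level hi = level lo + 1"
    using assms up_step_level by (auto simp: crosses_def)
  then have "int (steps_up hi) = (int (steps_up lo) - 1) mod int n"
    using label_crosses[OF assms] by (simp add: int_steps_up mod_simps algebra_simps)
  also have "\<dots> = int (steps_up lo) - 1"
    using \<open>steps_up lo \<noteq> 0\<close> steps_up_less[of lo] by (intro mod_pos_pos_trivial) auto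
  finally show ?thesis by simp
qed

definition up :: "square \<Rightarrow> square" where
  "up s = (SOME hi. crosses s hi)"

text \<open>The number of iterations is known in advance, so the top is a canonical representative
  of the chain, and tiles can be defined as fibres of this map, which are disjoint.\<close>

definition top_square :: "square \<Rightarrow> square" where
  "top_square s = (up ^^ steps_up s) s"

lemma top_square_crosses:
  assumes "crosses lo hi"
  shows "top_square lo = top_square hi"
proof -
  have "up lo = hi"
    using assms label(5)[of lo] crosses_in_R[OF assms] unfolding up_def by (metis someI)
  then show ?thesis
    by (simp add: top_square_def steps_up_crosses[OF assms] funpow_Suc_right del: funpow.simps)
qed

lemma top_square_steps_up_0: "steps_up s = 0 \<Longrightarrow> top_square s = s"
  by (simp add: top_square_def)

text \<open>Induction down a chain from its top: a nonzero number of steps guarantees a crossed edge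
  upwards, along which that number drops by one.\<close>

lemma steps_up_induct [consumes 1, case_names top step]:
  assumes "s \<in> R"
    and "\<And>s. s \<in> R \<Longrightarrow> steps_up s = 0 \<Longrightarrow> P s"
    and "\<And>lo hi. crosses lo hi \<Longrightarrow> P hi \<Longrightarrow> P lo"
  shows "P s"
  using assms(1)
proof (induction "steps_up s" arbitrary: s)
  case 0
  then show ?case using assms(2) by simp
next
  case (Suc k)
  then have "\<exists>hi. crosses s hi"
    using label(7)[of s] steps_up_eq_0_iff[of s] by simp
  then obtain hi where hi: "crosses s hi" by blast
  have "P hi"
    using Suc.hyps crosses_in_R[OF hi] steps_up_crosses[OF hi] by simp
  with hi show ?case by (rule assms(3))
qed

lemma top_square:
  assumes "s \<in> R"
  shows "top_square s \<in> R" "steps_up (top_square s) = 0" "label (top_square s) = label s"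
    "level (top_square s) = level s + int (steps_up s)"
proof -
  have "top_square s \<in> R \<and> steps_up (top_square s) = 0 \<and> label (top_square s) = label s \<and>
    level (top_square s) = level s + int (steps_up s)"
    using assms
  proof (induction rule: steps_up_induct)
    case (top s)
    then show ?case by (simp add: top_square_steps_up_0)
  next
    case (step lo hi)
    then have "level hi = level lo + 1"
      using up_step_level by (auto simp: crosses_def)
    then show ?case
      using step by (simp add: top_square_crosses label_crosses steps_up_crosses)
  qed
  then show "top_square s \<in> R" "steps_up (top_square s) = 0" "label (top_square s) = label s"
    "level (top_square s) = level s + int (steps_up s)" by auto
qed

text \<open>Climb from both squares in parallel until they meet at the top. Coming back down is
  unambiguous, since at most one crossed edge enters a square.\<close>

lemma top_square_inj:
  assumes "s \<in> R" "u \<in> R" "top_square s = top_square u" "steps_up s = steps_up u"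
  shows "s = u"
  using assms
proof (induction arbitrary: u rule: steps_up_induct)
  case (top s)
  then show ?case by (simp add: top_square_steps_up_0)
next
  case (step lo hi)
  then have "\<exists>v. crosses u v"
    using label(7)[of u] steps_up_eq_0_iff[of u] steps_up_crosses[of lo hi] by simp
  then obtain v where v: "crosses u v" by blast
  then have "hi = v"
    using step steps_up_crosses[OF v] steps_up_crosses[of lo hi] crosses_in_R[OF v]
    by (simp add: top_square_crosses)
  then show ?case
    using label(4)[of v lo u] v step crosses_in_R[OF v] by blast
qed

text \<open>The chain is extended downwards from r. At depth k the difference between label + 1 and
  the level is congruent to k + 1 modulo n, hence nonzero as long as k + 1 < n; so the color is not
  label + 1 and a crossed edge enters.\<close>

lemma ex_of_steps_up:
  assumes "r \<in> R" "steps_up r = 0" "k < n"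
  shows "\<exists>s\<in>R. top_square s = r \<and> steps_up s = k"
  using assms(3)
proof (induction k)
  case 0
  then show ?case using assms top_square_steps_up_0 by blast
next
  case (Suc k)
  then obtain s where s: "s \<in> R" "top_square s = r" "steps_up s = k" by auto
  have "color n s \<noteq> (label s + 1) mod n"
  proof
    assume eq: "color n s = (label s + 1) mod n"
    have "int (color n s) = int ((label s + 1) mod n)"
      using eq by simp
    then have "(int (label s) + 1) mod int n = level s mod int n"
      using n_pos by (simp add: color_def zmod_int add.commute)
    then have "int n dvd int (label s) + 1 - level s"
      by (simp only: mod_eq_dvd_iff)
    moreover have "int n dvd (int (label s) - level s) - int k"
      using dvd_minus_mod[of "int n" "int (label s) - level s"] s(3) int_steps_up[of s] by simp
    ultimately have "int n dvd (int (label s) + 1 - level s) - ((int (label s) - level s) - int k)"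
      by (rule dvd_diff)
    then have "int n dvd int (Suc k)" by simp
    then show False
      using Suc.prems by (auto dest!: zdvd_imp_le)
  qed
  then obtain lo where lo: "crosses lo s"
    using label(6)[OF s(1)] by blast
  then show ?case
    using s steps_up_crosses[OF lo] top_square_crosses[OF lo] crosses_in_R[OF lo] by auto
qed

definition tile :: "square \<Rightarrow> square set" where
  "tile r = {s \<in> R. top_square s = r}"

lemma ribbon_tile_tile:
  assumes "r \<in> R" "steps_up r = 0"
  shows "ribbon_tile n (tile r)"
  unfolding ribbon_tile_def
proof
  \<comment> \<open>Walks in both directions between s and the top r, so that any two squares of the
    tile are connected through r.\<close>
  have r: "s \<in> component (tile r) r \<and> r \<in> component (tile r) s" if "s \<in> tile r" for s
  proof -
    have "s \<in> R" "top_square s = r"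
      using that by (auto simp: tile_def)
    then show ?thesis
    proof (induction rule: steps_up_induct)
      case (top s)
      then show ?case by (simp add: top_square_steps_up_0 component_refl)
    next
      case (step lo hi)
      let ?T = "tile r"
      have "adjacent lo hi"
        using step.hyps up_step_adjacent by (simp add: crosses_def)
      then have T: "lo \<in> ?T" "hi \<in> ?T" "adjacent lo hi" "adjacent hi lo"
        using step.prems crosses_in_R[OF step.hyps] top_square_crosses[OF step.hyps] adjacent_sym
        by (simp_all add: tile_def)
      have "(r, hi) \<in> {(a, b). a \<in> ?T \<and> b \<in> ?T \<and> adjacent a b}\<^sup>*"
        using step T by (simp add: component_def tile_def)
      then have "lo \<in> component ?T r"
        using T by (auto simp: component_def intro: rtrancl_into_rtrancl)
      moreover have "r \<in> component ?T lo"
        using step T component_eq[of lo ?T hi] by (simp add: tile_def)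
      ultimately show ?case by blast
    qed
  qed
  show "connected_squares (tile r)"
    unfolding connected_squares_def
  proof (intro ballI)
    fix s t assume "s \<in> tile r" "t \<in> tile r"
    then show "t \<in> component (tile r) s"
      using r unfolding component_def by (blast intro: rtrancl_trans)
  qed
  have label_r: "label s = label r" if "s \<in> tile r" for s
    using that top_square(3)[of s] by (auto simp: tile_def)
  show "\<forall>c<n. \<exists>!s. s \<in> tile r \<and> color n s = c"
  proof (intro allI impI)
    fix c assume "c < n"
    \<comment> \<open>The depth at which color c has to occur, since colors decrease by one modulo n
      on the way down from the top, whose color is the label.\<close>
    define k where "k = nat ((int (label r) - int c) mod int n)"
    have k: "k < n" "int k = (int (label r) - int c) mod int n"
      using n_pos by (simp_all add: k_def nat_less_iff)
    obtain s where s: "s \<in> R" "top_square s = r" "steps_up s = k"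
      using ex_of_steps_up[OF assms k(1)] by blast
    then have "s \<in> tile r" by (simp add: tile_def)
    have "(int (label r) - level s) mod int n = (int (label r) - int c) mod int n"
      using s(3) k(2) int_steps_up[of s] label_r[OF \<open>s \<in> tile r\<close>] by simp
    then have "int n dvd int c - level s"
      by (simp add: mod_eq_dvd_iff)
    then have "level s mod int n = int c mod int n"
      unfolding mod_eq_dvd_iff by (subst dvd_diff_commute)
    then have "color n s = c"
      using \<open>c < n\<close> by (simp add: color_def)
    moreover have "u = s" if "u \<in> tile r" "color n u = c" for u
    proof -
      have "steps_up u = steps_up s"
        using label_r[OF that(1)] label_r[OF \<open>s \<in> tile r\<close>] \<open>color n s = c\<close> that(2)
          color_eq_iff[OF n_pos, of s u] by (simp add: steps_up_def mod_eq_dvd_iff eq_nat_nat_iff n_pos)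
      then show ?thesis
        using top_square_inj[of u s] that(1) s by (simp add: tile_def)
    qed
    ultimately show "\<exists>!s. s \<in> tile r \<and> color n s = c"
      using \<open>s \<in> tile r\<close> by blast
  qed
qed

lemma tile_type_tile:
  assumes "s \<in> R" "tile_type n (tile (top_square s)) j"
  shows "j = label s"
proof -
  let ?r = "top_square s"
  obtain u where u: "u \<in> tile ?r" "\<forall>x\<in>tile ?r. level x \<le> level u" "color n u = j"
    using assms(2) by (auto simp: tile_type_def)
  have r: "?r \<in> R" "steps_up ?r = 0" using top_square assms(1) by auto
  then have "?r \<in> tile ?r" by (simp add: tile_def top_square_steps_up_0)
  then have "level ?r \<le> level u" using u by blast
  moreover have "level u \<le> level ?r"
    using u(1) top_square(4)[of u] by (auto simp: tile_def)
  ultimately have "color n ?r = j"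
    using u(3) by (simp add: color_def)
  then show ?thesis
    using steps_up_eq_0_iff[OF r(1)] r(2) top_square(3)[OF assms(1)] by simp
qed

text \<open>A tile must not contain two adjacent squares whose common edge is plain. Their levels
  differ by 1, so hi has the number of steps of the successor of lo in the chain, and a tile has
  only one square with that number.\<close>

lemma same_tile_iff_crosses:
  assumes "up_step lo hi" "lo \<in> R" "hi \<in> R"
  shows "top_square lo = top_square hi \<longleftrightarrow> crosses lo hi"
proof
  assume eq: "top_square lo = top_square hi"
  have "steps_up lo = Suc (steps_up hi)"
    using top_square(4)[of lo] top_square(4)[of hi] eq assms up_step_level[of lo hi] by simp
  then have "\<exists>u. crosses lo u"
    using label(7)[of lo] steps_up_eq_0_iff[of lo] assms by simp
  then obtain u where u: "crosses lo u" by blast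
  have "u = hi"
    using top_square_inj[of u hi] steps_up_crosses[OF u] top_square_crosses[OF u]
      crosses_in_R[OF u] eq assms \<open>steps_up lo = Suc (steps_up hi)\<close> by simp
  then show "crosses lo hi" using u by simp
qed (rule top_square_crosses)

theorem ex_ribbon_tiling:
  "\<exists>\<alpha>\<in>ribbon_tilings n R. \<forall>lo hi i. up_step lo hi \<longrightarrow> lo \<in> R \<or> hi \<in> R \<longrightarrow> i < n \<longrightarrow>
     F lo hi i = tiling_increment n \<alpha> lo hi i"
proof
  let ?\<alpha> = "(\<lambda>s. tile (top_square s)) ` R"
  show \<alpha>: "?\<alpha> \<in> ribbon_tilings n R"
    unfolding ribbon_tilings_def partition_on_def
    using top_square ribbon_tile_tile by (auto simp: tile_def disjoint_def)
  show "\<forall>lo hi i. up_step lo hi \<longrightarrow> lo \<in> R \<or> hi \<in> R \<longrightarrow> i < n \<longrightarrow>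
     F lo hi i = tiling_increment n ?\<alpha> lo hi i"
  proof (intro allI impI)
    fix lo hi i assume step: "up_step lo hi" "lo \<in> R \<or> hi \<in> R" and "i < n"
    show "F lo hi i = tiling_increment n ?\<alpha> lo hi i"
    proof (cases "crosses lo hi")
      case True
      then have R: "lo \<in> R" "hi \<in> R" using crosses_in_R by auto
      let ?t = "tile (top_square lo)"
      have "?t \<in> ?\<alpha>" "lo \<in> ?t" "hi \<in> ?t"
        using R top_square_crosses[OF True] by (auto simp: tile_def)
      moreover from \<open>?t \<in> ?\<alpha>\<close> have "ribbon_tile n ?t"
        using \<alpha> unfolding ribbon_tilings_def by blast
      then have "tile_type n ?t (label lo)"
        using ex_tile_type[OF _ n_pos] tile_type_tile[OF R(1)] by blast
      moreover have "carries lo hi (label lo)"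
        using label(3)[OF R(1) True] .
      ultimately show ?thesis
        using tiling_increment_tile[OF \<alpha>, of ?t "label lo" lo hi] \<open>i < n\<close>
        by (simp add: carries_def)
    next
      case False
      then have "\<not> (\<exists>t\<in>?\<alpha>. lo \<in> t \<and> hi \<in> t)"
        using same_tile_iff_crosses[OF step(1)] by (auto simp: tile_def)
      moreover have "plain lo hi"
        using False step by (simp add: crosses_def)
      ultimately show ?thesis
        using \<open>i < n\<close> tiling_increment_no_tile[of ?\<alpha> lo hi n i] by (simp add: plain_def)
    qed
  qed
qed

end

section \<open>Height functions of tilings\<close>

unbundle no vec_syntax

lemma vec_eq_iff_index:
  "x \<in> carrier_vec n \<Longrightarrow> y \<in> carrier_vec n \<Longrightarrow> x = y \<longleftrightarrow> (\<forall>i<n. x $ i = y $ i)"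
  by (auto simp: vec_eq_iff)

lemma eq_unit_vec_iff:
  assumes "x \<in> carrier_vec n" "c < n"
  shows "x = unit_vec n c \<longleftrightarrow> (\<forall>i<n. x $ i = (of_bool (i = c) :: int))"
  using assms by (subst vec_eq_iff_index) (auto split: if_splits)

lemma eq_crossed_vec_iff:
  assumes "x \<in> carrier_vec n" "c < n" "j < n"
  shows "x = 2 \<cdot>\<^sub>v unit_vec n j - unit_vec n c \<longleftrightarrow>
    (\<forall>i<n. x $ i = 2 * of_bool (i = j) - (of_bool (i = c) :: int))"
  using assms by (subst vec_eq_iff_index) auto

text \<open>An interior edge can be read from either of its squares; these are adjacent and both
  contain its endpoints, so they name the same vertices.\<close>

lemma region_edge_unique:
  assumes "region_edge R lo hi v w" "region_edge R lo hi v' w'"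
  shows "v = v' \<and> w = w'"
proof -
  obtain p q s where 1: "grid_edge p q lo hi" "s \<in> R \<inter> {lo, hi}"
    "v = vertex_at R p s" "w = vertex_at R q s"
    using assms(1) unfolding region_edge_def by blast
  obtain p' q' s' where 2: "grid_edge p' q' lo hi" "s' \<in> R \<inter> {lo, hi}"
    "v' = vertex_at R p' s'" "w' = vertex_at R q' s'"
    using assms(2) unfolding region_edge_def by blast
  have pq: "p' = p" "q' = q"
    using 1(1) 2(1) by (auto elim!: grid_edge.cases)
  have corners: "p \<in> corners s" "q \<in> corners s" "p \<in> corners s'" "q \<in> corners s'"
    using grid_edge_in_corners[OF 1(1)] 1(2) 2(2) by auto
  have "adjacent lo hi" "adjacent hi lo"
    using up_step_adjacent[OF grid_edge_up_step[OF 1(1)]] adjacent_sym by auto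
  then have "s = s' \<or> adjacent s s'"
    using 1(2) 2(2) by auto
  then show ?thesis
    using vertex_at_eq[of s R s' p] vertex_at_eq[of s R s' q] corners 1 2 pq by auto
qed

lemma ex_region_edge:
  assumes "up_step lo hi" "lo \<in> R \<or> hi \<in> R"
  shows "\<exists>v w. region_edge R lo hi v w"
proof -
  obtain p q where "grid_edge p q lo hi"
    using ex_grid_edge_up_step[OF assms(1)] by blast
  then show ?thesis
    using assms(2) region_edgeI by blast
qed

lemma region_edge_up_step:
  "region_edge R lo hi v w \<Longrightarrow> up_step lo hi \<and> (lo \<in> R \<or> hi \<in> R)"
  unfolding region_edge_def using grid_edge_up_step by blast

lemma region_edge_carrier:
  assumes "h \<in> vertices R \<rightarrow>\<^sub>E carrier_vec n" "region_edge R lo hi v w"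
  shows "h v \<in> carrier_vec n" "h w \<in> carrier_vec n"
  using assms region_edge_vertices PiE_mem by metis+

text \<open>The clause for crossed edges ranges over tiles and types. Tiles are disjoint and each
  has exactly one type, so on a crossed edge it amounts to one vector equation.\<close>

lemma is_height_function_iff:
  assumes "n > 0" and \<alpha>: "\<alpha> \<in> ribbon_tilings n R"
  shows "is_height_function n R v0 \<alpha> h \<longleftrightarrow>
     h \<in> vertices R \<rightarrow>\<^sub>E carrier_vec n \<and> h v0 = 0\<^sub>v n \<and>
     (\<forall>lo hi v w. region_edge R lo hi v w \<longrightarrow>
        (\<forall>i<n. h w $ i - h v $ i = tiling_increment n \<alpha> lo hi i))"
proof -
  have "((\<nexists>t. t \<in> \<alpha> \<and> lo \<in> t \<and> hi \<in> t) \<longrightarrow> h w - h v = unit_vec n (color n lo)) \<and>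
      (\<forall>t j. t \<in> \<alpha> \<and> lo \<in> t \<and> hi \<in> t \<and> tile_type n t j \<longrightarrow>
         h w - h v = 2 \<cdot>\<^sub>v unit_vec n j - unit_vec n (color n lo)) \<longleftrightarrow>
      (\<forall>i<n. h w $ i - h v $ i = tiling_increment n \<alpha> lo hi i)"
    if h: "h \<in> vertices R \<rightarrow>\<^sub>E carrier_vec n" and e: "region_edge R lo hi v w" for lo hi v w
  proof -
    have carrier: "h v \<in> carrier_vec n" "h w \<in> carrier_vec n"
      by (rule region_edge_carrier[OF h e])+
    then have diff: "h w - h v \<in> carrier_vec n" by simp
    have index: "(h w - h v) $ i = h w $ i - h v $ i" if "i < n" for i
      using that carrier by simp
    have c: "color n lo < n" using color_less[OF \<open>n > 0\<close>] .
    show ?thesis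
    proof (cases "\<exists>t\<in>\<alpha>. lo \<in> t \<and> hi \<in> t")
      case True
      then obtain t where t: "t \<in> \<alpha>" "lo \<in> t" "hi \<in> t" by blast
      then have "ribbon_tile n t" using \<alpha> by (auto simp: ribbon_tilings_def)
      then obtain j where j: "j < n" "tile_type n t j"
        using ex_tile_type[OF _ \<open>n > 0\<close>] by blast
      have "u = t \<and> k = j" if "u \<in> \<alpha>" "lo \<in> u" "tile_type n u k" for u k
        using ribbon_tiling_unique[OF \<alpha> that(1) t(1) that(2) t(2)] tile_type_unique that(3) j(2)
        by metis
      then have "(\<forall>u k. u \<in> \<alpha> \<and> lo \<in> u \<and> hi \<in> u \<and> tile_type n u k \<longrightarrow>
          h w - h v = 2 \<cdot>\<^sub>v unit_vec n k - unit_vec n (color n lo)) \<longleftrightarrow>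
          h w - h v = 2 \<cdot>\<^sub>v unit_vec n j - unit_vec n (color n lo)"
        using t j(2) by blast
      also have "\<dots> \<longleftrightarrow> (\<forall>i<n. h w $ i - h v $ i = tiling_increment n \<alpha> lo hi i)"
        unfolding eq_crossed_vec_iff[OF diff c j(1)]
          tiling_increment_tile[OF \<alpha> t(1) j(2) t(2,3)] by (simp add: index)
      finally show ?thesis using t by blast
    next
      case False
      have "h w - h v = unit_vec n (color n lo) \<longleftrightarrow>
          (\<forall>i<n. h w $ i - h v $ i = tiling_increment n \<alpha> lo hi i)"
        unfolding eq_unit_vec_iff[OF diff c] tiling_increment_no_tile[OF False] by (simp add: index)
      then show ?thesis using False by blast
    qed
  qed
  then show ?thesis
    unfolding is_height_function_def by (intro conj_cong refl all_cong1 imp_cong)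
qed

lemma vertex_vec_unique:
  assumes R: "connected_squares R" and v0: "v0 \<in> vertices R"
    and h: "h \<in> vertices R \<rightarrow>\<^sub>E carrier_vec n" "h' \<in> vertices R \<rightarrow>\<^sub>E carrier_vec n" "h v0 = h' v0"
    and edge: "\<And>lo hi v w i. region_edge R lo hi v w \<Longrightarrow> i < n \<Longrightarrow>
      h w $ i - h v $ i = h' w $ i - (h' v $ i :: int)"
  shows "h = h'"
proof (rule PiE_ext[OF h(1,2)])
  fix v assume v: "v \<in> vertices R"
  have "h v $ i = h' v $ i" if "i < n" for i
  proof -
    have "h v $ i - h' v $ i = h v0 $ i - h' v0 $ i"
    proof (rule constant_on_vertices[OF R _ v v0])
      fix lo hi v w assume "region_edge R lo hi v w"
      from edge[OF this that] show "h v $ i - h' v $ i = h w $ i - h' w $ i" by simp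
    qed
    then show ?thesis using h(3) by simp
  qed
  moreover have "h v \<in> carrier_vec n" "h' v \<in> carrier_vec n"
    using PiE_mem[OF h(1) v] PiE_mem[OF h(2) v] .
  ultimately show "h v = h' v"
    by (simp add: vec_eq_iff_index)
qed

lemma ex1_height_function:
  assumes "n > 0" and R: "simply_connected_region R" and v0: "v0 \<in> vertices R"
    and \<alpha>: "\<alpha> \<in> ribbon_tilings n R"
  shows "\<exists>!h. is_height_function n R v0 \<alpha> h"
proof -
  have "\<forall>i. \<exists>H :: vertex \<Rightarrow> int. \<forall>lo hi v w. region_edge R lo hi v w \<longrightarrow>
      H w - H v = tiling_increment n \<alpha> lo hi i"
    using ex_vertex_potential[OF R balanced_tiling_increment[OF \<open>n > 0\<close> \<alpha>]] by blast
  then obtain H :: "nat \<Rightarrow> vertex \<Rightarrow> int" where H: "\<And>i lo hi v w. region_edge R lo hi v w \<Longrightarrow>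
      H i w - H i v = tiling_increment n \<alpha> lo hi i"
    by metis
  \<comment> \<open>The coordinates are integrated independently and shifted to vanish at
    v0.\<close>
  define h where "h = (\<lambda>v\<in>vertices R. Matrix.vec n (\<lambda>i. H i v - H i v0))"
  have "is_height_function n R v0 \<alpha> h"
    unfolding is_height_function_iff[OF \<open>n > 0\<close> \<alpha>]
  proof (intro conjI allI impI)
    show "h v0 = 0\<^sub>v n"
      using v0 by (auto simp: h_def)
    fix lo hi v w i assume e: "region_edge R lo hi v w" and "i < n"
    show "h w $ i - h v $ i = tiling_increment n \<alpha> lo hi i"
      using region_edge_vertices[OF e] H[OF e, of i] \<open>i < n\<close> by (simp add: h_def)
  qed (auto simp: h_def)
  moreover have "h' = h" if "is_height_function n R v0 \<alpha> h'" for h'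
  proof (rule vertex_vec_unique[OF _ v0])
    show "connected_squares R"
      using R by (simp add: simply_connected_region_def region_def)
  qed (use that \<open>is_height_function n R v0 \<alpha> h\<close> in \<open>auto simp: is_height_function_iff[OF \<open>n > 0\<close> \<alpha>]\<close>)
  ultimately show ?thesis by blast
qed

section \<open>The correspondence between tilings and local height functions\<close>

definition local_height_functions :: "nat \<Rightarrow> square set \<Rightarrow> vertex \<Rightarrow> (vertex \<Rightarrow> int Matrix.vec) set" where
  "local_height_functions n R v0 =
     {h \<in> vertices R \<rightarrow>\<^sub>E carrier_vec n.
       h v0 = 0\<^sub>v n \<and>
       (\<forall>lo hi v w. boundary_edge R lo hi v w \<longrightarrow>
          h w - h v = unit_vec n (color n lo)) \<and>
       (\<forall>lo hi v w. interior_edge R lo hi v w \<longrightarrow>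
          h w - h v \<in> {unit_vec n (color n lo)} \<union>
            {2 \<cdot>\<^sub>v unit_vec n j - unit_vec n (color n lo) | j. j < n \<and> j \<noteq> color n lo})}"

lemma height_function_local:
  assumes "n > 0" and \<alpha>: "\<alpha> \<in> ribbon_tilings n R" and h: "is_height_function n R v0 \<alpha> h"
  shows "h \<in> local_height_functions n R v0"
proof -
  have plain: "h w - h v = unit_vec n (color n lo)"
    if "region_edge R lo hi v w" "\<nexists>t. t \<in> \<alpha> \<and> lo \<in> t \<and> hi \<in> t" for lo hi v w
    using h that unfolding is_height_function_def by blast
  have boundary: "h w - h v = unit_vec n (color n lo)" if "boundary_edge R lo hi v w" for lo hi v w
  proof (rule plain)
    show "region_edge R lo hi v w"
      using that by (simp add: boundary_edge_def)
    have "\<not> (lo \<in> R \<and> hi \<in> R)"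
      using that by (auto simp: boundary_edge_def)
    then show "\<nexists>t. t \<in> \<alpha> \<and> lo \<in> t \<and> hi \<in> t"
      using \<alpha> by (auto simp: ribbon_tilings_def partition_on_def)
  qed
  have interior: "h w - h v \<in> {unit_vec n (color n lo)} \<union>
      {2 \<cdot>\<^sub>v unit_vec n j - unit_vec n (color n lo) | j. j < n \<and> j \<noteq> color n lo}"
    if "interior_edge R lo hi v w" for lo hi v w
  proof (cases "\<exists>t\<in>\<alpha>. lo \<in> t \<and> hi \<in> t")
    case False
    then show ?thesis
      using plain[of lo hi v w] that by (auto simp: interior_edge_def)
  next
    case True
    then obtain t where t: "t \<in> \<alpha>" "lo \<in> t" "hi \<in> t" by blast
    then have rt: "ribbon_tile n t" using \<alpha> by (auto simp: ribbon_tilings_def)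
    then obtain j where j: "j < n" "tile_type n t j"
      using ex_tile_type[OF _ \<open>n > 0\<close>] by blast
    have e: "region_edge R lo hi v w"
      using that by (simp add: interior_edge_def)
    \<comment> \<open>The tile continues above lo, so lo is not its highest square, the only one of
      color j.\<close>
    then have "j \<noteq> color n lo"
      using tile_type_top_iff[OF rt \<open>n > 0\<close> j(2) t(2)] t(3) region_edge_up_step by blast
    moreover have "h w - h v = 2 \<cdot>\<^sub>v unit_vec n j - unit_vec n (color n lo)"
      using h e t j(2) unfolding is_height_function_def by blast
    ultimately show ?thesis using j(1) by blast
  qed
  show ?thesis
    unfolding local_height_functions_def
    using h boundary interior by (simp add: is_height_function_def)
qed

text \<open>The function h remembers which edges are crossed: on an edge crossing a tile of type (j,
  j+1), coordinate j of the increment is 2, whereas an uncrossed edge has only entries 0 and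
  1.\<close>

lemma height_function_inj:
  assumes "n > 0" and \<alpha>: "\<alpha> \<in> ribbon_tilings n R" and \<beta>: "\<beta> \<in> ribbon_tilings n R"
    and "is_height_function n R v0 \<alpha> h" "is_height_function n R v0 \<beta> h"
  shows "\<alpha> = \<beta>"
proof (rule ribbon_tilings_eqI[OF \<alpha> \<beta>])
  fix lo hi assume lohi: "up_step lo hi" "lo \<in> R" "hi \<in> R"
  obtain v w where e: "region_edge R lo hi v w"
    using ex_region_edge lohi by blast
  have crossed: "(\<exists>t\<in>\<gamma>. lo \<in> t \<and> hi \<in> t) \<longleftrightarrow> (\<exists>i<n. h w $ i - h v $ i \<noteq> of_bool (i = color n lo))"
    if \<gamma>: "\<gamma> \<in> ribbon_tilings n R" and h: "is_height_function n R v0 \<gamma> h" for \<gamma>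
  proof -
    have F: "h w $ i - h v $ i = tiling_increment n \<gamma> lo hi i" if "i < n" for i
      using h e that unfolding is_height_function_iff[OF \<open>n > 0\<close> \<gamma>] by blast
    show ?thesis
    proof (cases "\<exists>t\<in>\<gamma>. lo \<in> t \<and> hi \<in> t")
      case True
      then obtain t where t: "t \<in> \<gamma>" "lo \<in> t" "hi \<in> t" by blast
      then have rt: "ribbon_tile n t" using \<gamma> by (auto simp: ribbon_tilings_def)
      then obtain j where j: "j < n" "tile_type n t j"
        using ex_tile_type[OF _ \<open>n > 0\<close>] by blast
      have "j \<noteq> color n lo"
        using tile_type_top_iff[OF rt \<open>n > 0\<close> j(2) t(2)] t(3) lohi(1) by blast
      then have "h w $ j - h v $ j \<noteq> of_bool (j = color n lo)"
        using F[OF j(1)] tiling_increment_tile[OF \<gamma> t(1) j(2) t(2,3), of j] by simp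
      then show ?thesis using True j(1) by blast
    next
      case False
      then have "\<forall>i<n. h w $ i - h v $ i = of_bool (i = color n lo)"
        using F tiling_increment_no_tile[OF False] by simp
      then show ?thesis
        using False by blast
    qed
  qed
  show "(\<exists>t\<in>\<alpha>. lo \<in> t \<and> hi \<in> t) \<longleftrightarrow> (\<exists>t\<in>\<beta>. lo \<in> t \<and> hi \<in> t)"
    unfolding crossed[OF \<alpha> assms(4)] crossed[OF \<beta> assms(5)] ..
qed

lemma height_function_surj:
  assumes "n > 0" and h: "h \<in> local_height_functions n R v0"
  shows "\<exists>\<alpha>\<in>ribbon_tilings n R. is_height_function n R v0 \<alpha> h"
proof -
  have ext: "h \<in> vertices R \<rightarrow>\<^sub>E carrier_vec n" and "h v0 = 0\<^sub>v n"
    using h by (auto simp: local_height_functions_def)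
  \<comment> \<open>The increment depends on the two squares alone, because they determine the
    endpoints of their common edge.\<close>
  define F where "F lo hi i = (THE d. \<exists>v w. region_edge R lo hi v w \<and> d = h w $ i - h v $ i)" for lo hi i
  have F: "F lo hi i = h w $ i - h v $ i" if "region_edge R lo hi v w" for lo hi v w i
    unfolding F_def
  proof (rule the_equality)
    show "\<exists>v' w'. region_edge R lo hi v' w' \<and> h w $ i - h v $ i = h w' $ i - h v' $ i"
      using that by blast
  qed (use region_edge_unique[OF that] in blast)
  have "local_flow n R F"
  proof
    show "n > 0" by fact
    fix s i assume "s \<in> R"
    then show "balanced (\<lambda>lo hi. F lo hi i) s"
      using square_region_edges[of "fst s" "snd s" R, THEN F, of i] by (simp add: balanced_def)
  next
    fix lo hi i assume *: "up_step lo hi" "(lo \<in> R) \<noteq> (hi \<in> R)" "i < n"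
    then obtain v w where e: "region_edge R lo hi v w"
      using ex_region_edge by blast
    then have "boundary_edge R lo hi v w"
      using *(2) by (simp add: boundary_edge_def)
    then have "h w - h v = unit_vec n (color n lo)"
      using h unfolding local_height_functions_def by blast
    moreover have "h w - h v \<in> carrier_vec n"
      using region_edge_carrier[OF ext e] by simp
    ultimately show "F lo hi i = of_bool (i = color n lo)"
      using eq_unit_vec_iff[of "h w - h v" n "color n lo"] color_less[OF \<open>n > 0\<close>] \<open>i < n\<close>
        region_edge_carrier[OF ext e] F[OF e] by simp
  next
    fix lo hi assume *: "up_step lo hi" "lo \<in> R" "hi \<in> R"
    then obtain v w where e: "region_edge R lo hi v w"
      using ex_region_edge by blast
    have carrier: "h w - h v \<in> carrier_vec n"
      using region_edge_carrier[OF ext e] by simp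
    have index: "(h w - h v) $ i = F lo hi i" if "i < n" for i
      using region_edge_carrier[OF ext e] F[OF e] that by simp
    have c: "color n lo < n" using color_less[OF \<open>n > 0\<close>] .
    have "interior_edge R lo hi v w"
      using e * by (simp add: interior_edge_def)
    then have "h w - h v = unit_vec n (color n lo) \<or>
        (\<exists>j<n. j \<noteq> color n lo \<and> h w - h v = 2 \<cdot>\<^sub>v unit_vec n j - unit_vec n (color n lo))"
      using h unfolding local_height_functions_def by blast
    then show "(\<forall>i<n. F lo hi i = of_bool (i = color n lo)) \<or>
        (\<exists>j<n. j \<noteq> color n lo \<and> (\<forall>i<n. F lo hi i = 2 * of_bool (i = j) - of_bool (i = color n lo)))"
    proof (elim disjE exE conjE)
      assume "h w - h v = unit_vec n (color n lo)"
      then show ?thesis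
        unfolding eq_unit_vec_iff[OF carrier c] by (simp add: index)
    next
      fix j assume j: "j < n" "j \<noteq> color n lo"
        and "h w - h v = 2 \<cdot>\<^sub>v unit_vec n j - unit_vec n (color n lo)"
      then have "\<forall>i<n. F lo hi i = 2 * of_bool (i = j) - of_bool (i = color n lo)"
        unfolding eq_crossed_vec_iff[OF carrier c j(1)] by (simp add: index)
      with j show ?thesis by blast
    qed
  qed
  then obtain \<alpha> where \<alpha>: "\<alpha> \<in> ribbon_tilings n R"
    and inc: "\<And>lo hi i. up_step lo hi \<Longrightarrow> lo \<in> R \<or> hi \<in> R \<Longrightarrow> i < n \<Longrightarrow>
      F lo hi i = tiling_increment n \<alpha> lo hi i"
    using local_flow.ex_ribbon_tiling by blast
  have "is_height_function n R v0 \<alpha> h"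
    unfolding is_height_function_iff[OF \<open>n > 0\<close> \<alpha>]
  proof (intro conjI allI impI ext \<open>h v0 = 0\<^sub>v n\<close>)
    fix lo hi v w i assume "region_edge R lo hi v w" "i < n"
    then show "h w $ i - h v $ i = tiling_increment n \<alpha> lo hi i"
      using F inc region_edge_up_step by metis
  qed
  with \<alpha> show ?thesis by blast
qed

theorem mainTheorem5:
  fixes n :: nat and R :: "square set" and v0 :: vertex
  assumes "n > 0"
    and "simply_connected_region R"
    and "v0 \<in> boundary_vertices R"
  shows "(\<forall>\<alpha> \<in> ribbon_tilings n R. \<exists>!h. is_height_function n R v0 \<alpha> h) \<and>
    bij_betw (height_function n R v0) (ribbon_tilings n R)
      {h \<in> vertices R \<rightarrow>\<^sub>E carrier_vec n.
         h v0 = 0\<^sub>v n \<and>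
         (\<forall>lo hi v w. boundary_edge R lo hi v w \<longrightarrow>
            h w - h v = unit_vec n (color n lo)) \<and>
         (\<forall>lo hi v w. interior_edge R lo hi v w \<longrightarrow>
            h w - h v \<in> {unit_vec n (color n lo)} \<union>
              {2 \<cdot>\<^sub>v unit_vec n j - unit_vec n (color n lo) | j. j < n \<and> j \<noteq> color n lo})}"
  unfolding local_height_functions_def[symmetric]
proof
  have v0: "v0 \<in> vertices R"
    using assms(3) boundary_vertices_subset by blast
  show ex1: "\<forall>\<alpha> \<in> ribbon_tilings n R. \<exists>!h. is_height_function n R v0 \<alpha> h"
    using ex1_height_function[OF assms(1,2) v0] by blast
  have hf: "is_height_function n R v0 \<alpha> (height_function n R v0 \<alpha>)"
    if "\<alpha> \<in> ribbon_tilings n R" for \<alpha>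
    unfolding height_function_def by (rule theI'[OF bspec[OF ex1 that]])
  show "bij_betw (height_function n R v0) (ribbon_tilings n R) (local_height_functions n R v0)"
  proof (rule bij_betw_imageI)
    show "inj_on (height_function n R v0) (ribbon_tilings n R)"
      using hf height_function_inj[OF assms(1)] by (metis inj_onI)
    show "height_function n R v0 ` ribbon_tilings n R = local_height_functions n R v0"
    proof
      show "height_function n R v0 ` ribbon_tilings n R \<subseteq> local_height_functions n R v0"
        using hf height_function_local[OF assms(1)] by blast
      show "local_height_functions n R v0 \<subseteq> height_function n R v0 ` ribbon_tilings n R"
      proof
        fix h assume "h \<in> local_height_functions n R v0"
        then obtain \<alpha> where "\<alpha> \<in> ribbon_tilings n R" "is_height_function n R v0 \<alpha> h"
          using height_function_surj[OF assms(1)] by blast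
        then show "h \<in> height_function n R v0 ` ribbon_tilings n R"
          using ex1 hf by (metis image_eqI)
      qed
    qed
  qed
qed

end
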